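(* Let $H$ be a Hopf algebra over a field $\Bbbk$ with antipode $S$, and let $H_1,H_2,H_3,H_4$ be the Yetter-Drinfel'd-Long bimodule structures on the vector space $H\otimes H$ given by, for all $h,k,l\in H$: \begin{itemize} \item $H_1$: $h\triangleright(k\otimes l)=hk\otimes l$, $\rho^l(k\otimes l)=k_1S(k_3)\otimes(k_2\otimes l)$, $(k\otimes l)\triangleleft h=k\otimes S(h_1)lh_2$, $\rho^r(k\otimes l)=(k\otimes l_1)\otimes l_2$; \item $H_2$: $h\triangleright(k\otimes l)=h_1kS(h_2)\otimes l$, $\rho^l(k\otimes l)=k_1\otimes(k_2\otimes l)$, $(k\otimes l)\triangleleft h=k\otimes lh$, $\rho^r(k\otimes l)=(k\otimes l_2)\otimes S(l_1)l_3$; \item $H_3$: $h\triangleright(k\otimes l)=hk\otimes l$, $\rho^l(k\otimes l)=k_1S(k_3)\otimes(k_2\otimes l)$, $(k\otimes l)\triangleleft h=k\otimes lh$, $\rho^r(k\otimes l)=(k\otimes l_2)\otimes S(l_1)l_3$; \item $H_4$: $h\triangleright(k\otimes l)=h_1kS(h_2)\otimes l$, $\rho^l(k\otimes l)=k_1\otimes(k_2\otimes l)$, $(k\otimes l)\triangleleft h=k\otimes S(h_1)lh_2$, $\rho^r(k\otimes l)=(k\otimes l_1)\otimes l_2$. \end{itemize} Then: (1) $H_1$ satisfies the $u$-condition if and only if $S^2=\mathrm{id}$. (2) $H_2$ satisfies the $u$-condition if and only if $S^2=\mathrm{id}$. (3) $H_3$ satisfies the $u$-condition if and only if $S^2=\mathrm{id}$.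 (4) $H_4$ satisfies the $u$-condition if and only if $S^2=\mathrm{id}$.
   Context: Everything is over a field $\Bbbk$; Sweedler notation $\Delta(h)=h_1\otimes h_2$ is used with summation omitted. A Yetter-Drinfel'd-Long bimodule over a Hopf algebra $H$ is a vector space $M$ which is an $H$-bimodule (left action $h\otimes m\mapsto h\triangleright m$, right action $m\otimes h\mapsto m\triangleleft h$, with $(a\triangleright m)\triangleleft b=a\triangleright(m\triangleleft b)$) and an $H$-bicomodule (left coaction $\rho^l(m)=m_{[-1]}\otimes m_{[0]}\in H\otimes M$, right coaction $\rho^r(m)=m_{(0)}\otimes m_{(1)}\in M\otimes H$, with $m_{[-1]}\otimes m_{[0](0)}\otimes m_{[0](1)}=m_{(0)[-1]}\otimes m_{(0)[0]}\otimes m_{(1)}$), such that for all $h\in H$, $m\in M$: $(h_1\triangleright m)_{[-1]}h_2\otimes(h_1\triangleright m)_{[0]}=h_1m_{[-1]}\otimes h_2\triangleright m_{[0]}$; $(h\triangleright m)_{(0)}\otimes(h\triangleright m)_{(1)}=h\triangleright m_{(0)}\otimes m_{(1)}$; $(m\triangleleft h_2)_{(0)}\otimes h_1(m\triangleleft h_2)_{(1)}=m_{(0)}\triangleleft h_1\otimes m_{(1)}h_2$; $(m\triangleleft h)_{[-1]}\otimes(m\triangleleft h)_{[0]}=m_{[-1]}\otimes m_{[0]}\triangleleft h$. Such an $M$ satisfies the $u$-condition if $m_{[-1]}\triangleright m_{[0](0)}\triangleleft m_{[0](1)}=m$ for all $m\in M$. *)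

theory Defs
  imports "HOL.Vector_Spaces"
begin

section \<open>Vector spaces and linear maps\<close>

text \<open>
  A vector space is a subspace \<open>carrier V\<close> of an ambient vector space whose elements form
  the whole type \<open>'v\<close>. The carrier is needed because a tensor product of two spaces is only
  available as a subset of a type.
\<close>

record ('k, 'v) space =
  carrier :: "'v set"
  scale :: "'k \<Rightarrow> 'v \<Rightarrow> 'v"

definition is_space :: "('k::field, 'v::ab_group_add, 'z) space_scheme \<Rightarrow> bool" where
  "is_space V \<longleftrightarrow> vector_space (scale V) \<and> module.subspace (scale V) (carrier V)"

text \<open>
  In \<open>lin\<close> and \<open>bilin\<close> only the scalar multiplication \<open>s\<close> of the target is given; that values lie
  in a smaller target space is required separately where it matters.
\<close>

definition lin ::
  "('k, 'v::ab_group_add, 'z) space_scheme \<Rightarrow> ('k \<Rightarrow> 'u::ab_group_add \<Rightarrow> 'u) \<Rightarrow> ('v \<Rightarrow> 'u) \<Rightarrow> bool"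
  where
  "lin V s f \<longleftrightarrow>
    (\<forall>x\<in>carrier V. \<forall>y\<in>carrier V. f (x + y) = f x + f y) \<and>
    (\<forall>c. \<forall>x\<in>carrier V. f (scale V c x) = s c (f x))"

definition bilin ::
  "('k, 'v::ab_group_add, 'z) space_scheme \<Rightarrow> ('k, 'w::ab_group_add, 'y) space_scheme \<Rightarrow>
    ('k \<Rightarrow> 'u::ab_group_add \<Rightarrow> 'u) \<Rightarrow> ('v \<Rightarrow> 'w \<Rightarrow> 'u) \<Rightarrow> bool" where
  "bilin V W s F \<longleftrightarrow>
    (\<forall>w\<in>carrier W. lin V s (\<lambda>v. F v w)) \<and> (\<forall>v\<in>carrier V. lin W s (\<lambda>w. F v w))"

section \<open>Tensor products\<close>

text \<open>
  The tensor product of \<open>V\<close> and \<open>W\<close> is realised inside the dual of the space of bilinear forms on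
  \<open>V \<times> W\<close>: the pure tensor of \<open>v\<close> and \<open>w\<close> is evaluation at \<open>(v, w)\<close>, and the tensor product
  consists of the finite sums of pure tensors. Over a field this is the usual tensor product;
  its universal property is \<open>tensor_universal\<close> below.
\<close>

typedef ('k, 'v, 'w) tensor = "UNIV :: (('v \<Rightarrow> 'w \<Rightarrow> 'k) \<Rightarrow> 'k) set"
  morphisms functional_of Tensor ..

setup_lifting type_definition_tensor

instantiation tensor :: (ab_group_add, type, type) ab_group_add
begin

lift_definition zero_tensor :: "('a, 'b, 'c) tensor" is "\<lambda>\<beta>. 0" .
lift_definition plus_tensor :: "('a, 'b, 'c) tensor \<Rightarrow> ('a, 'b, 'c) tensor \<Rightarrow> ('a, 'b, 'c) tensor"
  is "\<lambda>x y \<beta>. x \<beta> + y \<beta>" .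
lift_definition uminus_tensor :: "('a, 'b, 'c) tensor \<Rightarrow> ('a, 'b, 'c) tensor" is "\<lambda>x \<beta>. - x \<beta>" .
lift_definition minus_tensor :: "('a, 'b, 'c) tensor \<Rightarrow> ('a, 'b, 'c) tensor \<Rightarrow> ('a, 'b, 'c) tensor"
  is "\<lambda>x y \<beta>. x \<beta> - y \<beta>" .

instance
  by standard (transfer; simp add: algebra_simps)+

end

lift_definition tscale :: "'k::field \<Rightarrow> ('k, 'v, 'w) tensor \<Rightarrow> ('k, 'v, 'w) tensor"
  is "\<lambda>c x \<beta>. c * x \<beta>" .

lift_definition tens ::
  "('k::field, 'v::ab_group_add, 'z) space_scheme \<Rightarrow> ('k, 'w::ab_group_add, 'y) space_scheme \<Rightarrow>
    'v \<Rightarrow> 'w \<Rightarrow> ('k, 'v, 'w) tensor"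
  is "\<lambda>V W v w \<beta>. if bilin V W (*) \<beta> then \<beta> v w else 0" .

definition lsum :: "('v \<Rightarrow> 'w \<Rightarrow> 'u::comm_monoid_add) \<Rightarrow> ('v \<times> 'w) list \<Rightarrow> 'u" where
  "lsum F ps = (\<Sum>(v, w)\<leftarrow>ps. F v w)"

definition tensor ::
  "('k::field, 'v::ab_group_add, 'z) space_scheme \<Rightarrow> ('k, 'w::ab_group_add, 'y) space_scheme \<Rightarrow>
    ('k, ('k, 'v, 'w) tensor) space" where
  "tensor V W =
    \<lparr>carrier = {lsum (tens V W) ps |ps. set ps \<subseteq> carrier V \<times> carrier W}, scale = tscale\<rparr>"

text \<open>
  \<open>tlift V W F\<close> is the linear map induced by a bilinear map \<open>F\<close>: it sends a tensor
  \<open>v\<^sub>1 \<otimes> w\<^sub>1 + ... + v\<^sub>n \<otimes> w\<^sub>n\<close> to \<open>F v\<^sub>1 w\<^sub>1 + ... + F v\<^sub>n w\<^sub>n\<close>. The result does not depend on the chosen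
  representation when \<open>F\<close> is bilinear (\<open>tlift_lsum\<close>).
\<close>

definition tensor_rep ::
  "('k::field, 'v::ab_group_add, 'z) space_scheme \<Rightarrow> ('k, 'w::ab_group_add, 'y) space_scheme \<Rightarrow>
    ('k, 'v, 'w) tensor \<Rightarrow> ('v \<times> 'w) list" where
  "tensor_rep V W x = (SOME ps. set ps \<subseteq> carrier V \<times> carrier W \<and> x = lsum (tens V W) ps)"

definition tlift ::
  "('k::field, 'v::ab_group_add, 'z) space_scheme \<Rightarrow> ('k, 'w::ab_group_add, 'y) space_scheme \<Rightarrow>
    ('v \<Rightarrow> 'w \<Rightarrow> 'u::comm_monoid_add) \<Rightarrow> ('k, 'v, 'w) tensor \<Rightarrow> 'u" where
  "tlift V W F x = lsum F (tensor_rep V W x)"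

lemma lsum_Nil [simp]: "lsum F [] = 0"
  and lsum_Cons [simp]: "lsum F (p # ps) = F (fst p) (snd p) + lsum F ps"
  and lsum_append [simp]: "lsum F (ps @ qs) = lsum F ps + lsum F qs"
  by (simp_all add: lsum_def case_prod_unfold)

lemma lsum_add: "lsum (\<lambda>v w. F v w + G v w) ps = lsum F ps + lsum G ps"
  by (induction ps) (simp_all add: algebra_simps)

lemma lsum_cong:
  "(\<And>v w. (v, w) \<in> set ps \<Longrightarrow> F v w = G v w) \<Longrightarrow> lsum F ps = lsum G ps"
  by (induction ps) auto

lemma lsum_zero [simp]: "lsum (\<lambda>v w. 0) ps = 0"
  by (induction ps) simp_all

lemma lsum_swap: "lsum (\<lambda>v w. lsum (F v w) qs) ps = lsum (\<lambda>a b. lsum (\<lambda>v w. F v w a b) ps) qs"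
  by (induction ps) (simp_all add: lsum_add)

lemma functional_of_lsum: "functional_of (lsum F ps) \<beta> = lsum (\<lambda>v w. functional_of (F v w) \<beta>) ps"
  by (induction ps) (simp_all add: zero_tensor.rep_eq plus_tensor.rep_eq)

lemma vector_space_tscale: "vector_space tscale"
  by unfold_locales (transfer; simp add: fun_eq_iff algebra_simps)+

lemma vector_space_times: "vector_space ((*) :: 'k::field \<Rightarrow> _)"
  by unfold_locales (auto simp: algebra_simps)

lemma is_space_add: "is_space V \<Longrightarrow> x \<in> carrier V \<Longrightarrow> y \<in> carrier V \<Longrightarrow> x + y \<in> carrier V"
  and is_space_scale: "is_space V \<Longrightarrow> x \<in> carrier V \<Longrightarrow> scale V c x \<in> carrier V"
  and is_space_0: "is_space V \<Longrightarrow> 0 \<in> carrier V"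
  by (auto simp: is_space_def module.subspace_def vector_space_def module_def)

lemma lin_zero:
  assumes "is_space V" "lin V s f"
  shows "f 0 = 0"
proof -
  have "f (0 + 0) = f 0 + f 0"
    using assms is_space_0 unfolding lin_def by blast
  then show ?thesis by simp
qed

lemma lsum_carrier:
  assumes "is_space U" "\<And>v w. (v, w) \<in> set ps \<Longrightarrow> F v w \<in> carrier U"
  shows "lsum F ps \<in> carrier U"
  using assms(2) by (induction ps) (auto intro: is_space_add is_space_0 assms(1))

lemma lin_lsum:
  assumes "is_space U" "lin U s f" "\<And>v w. (v, w) \<in> set ps \<Longrightarrow> F v w \<in> carrier U"
  shows "f (lsum F ps) = lsum (\<lambda>v w. f (F v w)) ps"
  using assms(3)
proof (induction ps)
  case (Cons p ps)
  have "F (fst p) (snd p) \<in> carrier U" "lsum F ps \<in> carrier U"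
    using Cons.prems assms(1) by (auto intro: lsum_carrier)
  then show ?case
    using assms(2) Cons by (simp add: lin_def)
qed (simp add: lin_zero[OF assms(1,2)])

lemma bilin_tens:
  assumes "is_space V" "is_space W"
  shows "bilin V W tscale (tens V W)"
  unfolding bilin_def lin_def by (transfer; auto simp: bilin_def lin_def fun_eq_iff)+

lemma lsum_tens_eqD:
  assumes sp: "vector_space (s :: 'k::field \<Rightarrow> 'u::ab_group_add \<Rightarrow> 'u)"
    and F: "bilin V W s F"
    and ps: "set ps \<subseteq> carrier V \<times> carrier W" and qs: "set qs \<subseteq> carrier V \<times> carrier W"
    and eq: "lsum (tens V W) ps = lsum (tens V W) qs"
  shows "lsum F ps = lsum F qs"
proof (rule ccontr)
  assume neq: "lsum F ps \<noteq> lsum F qs"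
  define d where "d = lsum F ps - lsum F qs"
  have d: "d \<noteq> 0" using neq by (simp add: d_def)
  interpret vs: vector_space s by fact
  interpret vector_space_pair s "(*) :: 'k \<Rightarrow> _"
    by (intro vector_space_pair.intro sp vector_space_times)
  obtain g where g: "Vector_Spaces.linear s (*) g" "g d = (1::'k)"
    using linear_independent_extend[of "{d}" "\<lambda>_. 1"] d by auto
  interpret g: Vector_Spaces.linear s "(*)" g by fact
  have bil: "bilin V W (*) (\<lambda>v w. g (F v w))"
    using F by (auto simp: bilin_def lin_def g.add g.scale)
  have *: "functional_of (lsum (tens V W) rs) (\<lambda>v w. g (F v w)) = g (lsum F rs)" for rs
    unfolding functional_of_lsum by (induction rs) (auto simp: tens.rep_eq bil g.add g.zero)
  have "g (lsum F ps) = g (lsum F qs)"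
    using eq *[of ps] *[of qs] by simp
  then have "g d = 0" by (simp add: d_def g.diff)
  with g show False by simp
qed

lemma tensor_rep:
  assumes "x \<in> carrier (tensor V W)"
  shows "set (tensor_rep V W x) \<subseteq> carrier V \<times> carrier W"
    and "x = lsum (tens V W) (tensor_rep V W x)"
proof -
  have "\<exists>ps. set ps \<subseteq> carrier V \<times> carrier W \<and> x = lsum (tens V W) ps"
    using assms by (auto simp: tensor_def)
  from someI_ex[OF this]
  show "set (tensor_rep V W x) \<subseteq> carrier V \<times> carrier W"
    and "x = lsum (tens V W) (tensor_rep V W x)"
    by (simp_all add: tensor_rep_def)
qed

lemma scale_tensor [simp]: "scale (tensor V W) = tscale"
  by (simp add: tensor_def)

lemma lsum_in_tensor: "set ps \<subseteq> carrier V \<times> carrier W \<Longrightarrow> lsum (tens V W) ps \<in> carrier (tensor V W)"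
  by (auto simp: tensor_def)

lemma tens_in_tensor: "v \<in> carrier V \<Longrightarrow> w \<in> carrier W \<Longrightarrow> tens V W v w \<in> carrier (tensor V W)"
  using lsum_in_tensor[of "[(v, w)]" V W] by simp

lemma is_space_tensor:
  assumes "is_space V" "is_space W"
  shows "is_space (tensor V W)"
proof -
  have "0 \<in> carrier (tensor V W)"
    using lsum_in_tensor[of "[]" V W] by simp
  moreover have "x + y \<in> carrier (tensor V W)"
    if "x \<in> carrier (tensor V W)" "y \<in> carrier (tensor V W)" for x y
  proof -
    have "x + y = lsum (tens V W) (tensor_rep V W x @ tensor_rep V W y)"
      using tensor_rep(2)[OF that(1)] tensor_rep(2)[OF that(2)] by simp
    moreover have "\<dots> \<in> carrier (tensor V W)"
      using tensor_rep(1)[OF that(1)] tensor_rep(1)[OF that(2)] by (intro lsum_in_tensor) auto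
    ultimately show ?thesis by simp
  qed
  moreover have "tscale c x \<in> carrier (tensor V W)" if "x \<in> carrier (tensor V W)" for c x
  proof -
    let ?ps = "map (\<lambda>(v, w). (scale V c v, w)) (tensor_rep V W x)"
    have *: "tscale c (lsum (tens V W) ps) = lsum (tens V W) (map (\<lambda>(v, w). (scale V c v, w)) ps)"
      if "set ps \<subseteq> carrier V \<times> carrier W" for ps
      using that
    proof (induction ps)
      case Nil
      show ?case by simp (transfer, simp)
    next
      case (Cons p ps)
      then show ?case
        using bilin_tens[OF assms]
        by (auto simp: bilin_def lin_def vector_space.vector_space_assms(1)[OF vector_space_tscale])
    qed
    have "tscale c x = lsum (tens V W) ?ps"
      using *[OF tensor_rep(1)[OF that]] tensor_rep(2)[OF that] by simp
    moreover have "\<dots> \<in> carrier (tensor V W)"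
      using tensor_rep(1)[OF that] by (intro lsum_in_tensor) (auto intro: is_space_scale assms)
    ultimately show ?thesis by simp
  qed
  ultimately show ?thesis
    using vector_space_tscale
    by (auto simp: is_space_def module.subspace_def vector_space_def module_def)
qed

lemma tlift_lsum:
  assumes "vector_space s" "bilin V W s F" "set ps \<subseteq> carrier V \<times> carrier W"
  shows "tlift V W F (lsum (tens V W) ps) = lsum F ps"
  unfolding tlift_def
  using tensor_rep[OF lsum_in_tensor[OF assms(3)]]
  by (intro lsum_tens_eqD[OF assms(1,2)] assms(3)) auto

lemma tlift_tens:
  assumes "vector_space s" "bilin V W s F" "v \<in> carrier V" "w \<in> carrier W"
  shows "tlift V W F (tens V W v w) = F v w"
  using tlift_lsum[OF assms(1,2), of "[(v, w)]"] assms(3,4) by simp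

lemma lin_on_tensor:
  assumes "is_space V" "is_space W" "lin (tensor V W) s f" and x: "x \<in> carrier (tensor V W)"
  shows "f x = tlift V W (\<lambda>v w. f (tens V W v w)) x"
proof -
  note r = tensor_rep[OF x]
  have "f (lsum (tens V W) (tensor_rep V W x)) = lsum (\<lambda>v w. f (tens V W v w)) (tensor_rep V W x)"
    using r(1) by (intro lin_lsum[OF is_space_tensor[OF assms(1,2)] assms(3)]) (auto intro: tens_in_tensor)
  then show ?thesis
    using r(2) by (simp add: tlift_def)
qed

lemma tlift_cong:
  assumes "x \<in> carrier (tensor V W)"
    and "\<And>v w. v \<in> carrier V \<Longrightarrow> w \<in> carrier W \<Longrightarrow> F v w = G v w"
  shows "tlift V W F x = tlift V W G x"
  unfolding tlift_def using tensor_rep(1)[OF assms(1)] by (intro lsum_cong assms(2)) auto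

lemma lin_eq_on_tensor:
  assumes "is_space V" "is_space W" "lin (tensor V W) s f" "lin (tensor V W) s g"
    and "\<And>v w. v \<in> carrier V \<Longrightarrow> w \<in> carrier W \<Longrightarrow> f (tens V W v w) = g (tens V W v w)"
    and x: "x \<in> carrier (tensor V W)"
  shows "f x = g x"
  using lin_on_tensor[OF assms(1,2,3) x] lin_on_tensor[OF assms(1,2,4) x]
    tlift_cong[OF x, of "\<lambda>v w. f (tens V W v w)" "\<lambda>v w. g (tens V W v w)"] assms(5)
  by simp

lemma lin_tlift:
  assumes V: "is_space V" and W: "is_space W" and s: "vector_space s" and F: "bilin V W s F"
  shows "lin (tensor V W) s (tlift V W F)"
proof -
  have add: "tlift V W F (x + y) = tlift V W F x + tlift V W F y"
    if "x \<in> carrier (tensor V W)" "y \<in> carrier (tensor V W)" for x y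
  proof -
    have "x + y = lsum (tens V W) (tensor_rep V W x @ tensor_rep V W y)"
      using tensor_rep(2)[OF that(1)] tensor_rep(2)[OF that(2)] by simp
    then have "tlift V W F (x + y) = lsum F (tensor_rep V W x @ tensor_rep V W y)"
      using tensor_rep(1)[OF that(1)] tensor_rep(1)[OF that(2)]
        tlift_lsum[OF s F, of "tensor_rep V W x @ tensor_rep V W y"] by simp
    then show ?thesis by (simp add: tlift_def)
  qed
  have sc: "tlift V W F (tscale c x) = s c (tlift V W F x)" if x: "x \<in> carrier (tensor V W)" for c x
  proof -
    let ?ps = "map (\<lambda>(v, w). (scale V c v, w)) (tensor_rep V W x)"
    note r = tensor_rep[OF x]
    interpret s: vector_space s by fact
    have gen: "lsum G (map (\<lambda>(v, w). (scale V c v, w)) ps) = t c (lsum G ps)"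
      if "vector_space t" "bilin V W t G" "set ps \<subseteq> carrier V \<times> carrier W"
      for ps and t :: "'a \<Rightarrow> 'x::ab_group_add \<Rightarrow> 'x" and G
    proof -
      interpret t: vector_space t by fact
      show ?thesis using that(3)
      proof (induction ps)
        case (Cons p ps)
        then show ?case using that(2)
          by (cases p) (auto simp: bilin_def lin_def t.scale_right_distrib)
      qed simp
    qed
    have "tscale c x = lsum (tens V W) ?ps"
      using gen[OF vector_space_tscale bilin_tens[OF V W] r(1)] r(2) by simp
    moreover have "set ?ps \<subseteq> carrier V \<times> carrier W"
      using r(1) by (auto intro: is_space_scale V)
    ultimately have "tlift V W F (tscale c x) = lsum F ?ps"
      using tlift_lsum[OF s F] by simp
    then show ?thesis
      using gen[OF s F r(1)] by (simp add: tlift_def)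
  qed
  from add sc show ?thesis by (simp add: lin_def)
qed

theorem tensor_universal:
  assumes "is_space V" "is_space W" "vector_space s" "bilin V W s F"
  shows "\<exists>f. lin (tensor V W) s f \<and> (\<forall>v\<in>carrier V. \<forall>w\<in>carrier W. f (tens V W v w) = F v w) \<and>
    (\<forall>g. lin (tensor V W) s g \<and> (\<forall>v\<in>carrier V. \<forall>w\<in>carrier W. g (tens V W v w) = F v w) \<longrightarrow>
      (\<forall>x\<in>carrier (tensor V W). g x = f x))"
  using lin_tlift[OF assms] tlift_tens[OF assms(3,4)]
  by (intro exI[of _ "tlift V W F"] conjI ballI allI impI)
    (simp_all, rule lin_eq_on_tensor[OF assms(1,2)], auto)

section \<open>Hopf algebras\<close>

text \<open>The underlying ring is the type \<open>'h\<close>; the record supplies the remaining structure maps.\<close>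

record ('k, 'h) hopf =
  hscale :: "'k \<Rightarrow> 'h \<Rightarrow> 'h"
  comul :: "'h \<Rightarrow> ('k, 'h, 'h) tensor"
  counit :: "'h \<Rightarrow> 'k"
  antipode :: "'h \<Rightarrow> 'h"

definition hspace :: "('k, 'h) hopf \<Rightarrow> ('k, 'h) space" where
  "hspace A = \<lparr>carrier = UNIV, scale = hscale A\<rparr>"

text \<open>
  Sweedler sums: \<open>sweedler A h F\<close> is the sum of all \<open>F h\<^sub>1 h\<^sub>2\<close> for
  \<open>\<Delta>(h) = h\<^sub>1 \<otimes> h\<^sub>2\<close>, and \<open>sweedler3 A h F\<close> is the sum of all \<open>F h\<^sub>1 h\<^sub>2 h\<^sub>3\<close>. These are only
  used for multilinear \<open>F\<close>.
\<close>

definition sweedler ::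
  "('k::field, 'h::ring_1) hopf \<Rightarrow> 'h \<Rightarrow> ('h \<Rightarrow> 'h \<Rightarrow> 'u::comm_monoid_add) \<Rightarrow> 'u" where
  "sweedler A h F = tlift (hspace A) (hspace A) F (comul A h)"

definition sweedler3 ::
  "('k::field, 'h::ring_1) hopf \<Rightarrow> 'h \<Rightarrow> ('h \<Rightarrow> 'h \<Rightarrow> 'h \<Rightarrow> 'u::comm_monoid_add) \<Rightarrow> 'u" where
  "sweedler3 A h F = sweedler A h (\<lambda>h\<^sub>1 h'. sweedler A h' (\<lambda>h\<^sub>2 h\<^sub>3. F h\<^sub>1 h\<^sub>2 h\<^sub>3))"

locale hopf_algebra =
  fixes A :: "('k::field, 'h::ring_1) hopf"
  assumes hscale_vector_space: "vector_space (hscale A)"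
    and hscale_mult_left: "hscale A c x * y = hscale A c (x * y)"
    and hscale_mult_right: "x * hscale A c y = hscale A c (x * y)"
    and comul_closed: "comul A h \<in> carrier (tensor (hspace A) (hspace A))"
    and comul_lin: "lin (hspace A) tscale (comul A)"
    and comul_coassoc:
      "sweedler A h (\<lambda>h' h\<^sub>3. sweedler A h' (\<lambda>h\<^sub>1 h\<^sub>2.
          tens (hspace A) (tensor (hspace A) (hspace A)) h\<^sub>1 (tens (hspace A) (hspace A) h\<^sub>2 h\<^sub>3))) =
       sweedler A h (\<lambda>h\<^sub>1 h'. sweedler A h' (\<lambda>h\<^sub>2 h\<^sub>3.
          tens (hspace A) (tensor (hspace A) (hspace A)) h\<^sub>1 (tens (hspace A) (hspace A) h\<^sub>2 h\<^sub>3)))"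
    and counit_lin: "lin (hspace A) (*) (counit A)"
    and counit_left: "sweedler A h (\<lambda>h\<^sub>1 h\<^sub>2. hscale A (counit A h\<^sub>1) h\<^sub>2) = h"
    and counit_right: "sweedler A h (\<lambda>h\<^sub>1 h\<^sub>2. hscale A (counit A h\<^sub>2) h\<^sub>1) = h"
    and comul_one: "comul A 1 = tens (hspace A) (hspace A) 1 1"
    and comul_mult: "comul A (g * h) =
      sweedler A g (\<lambda>g\<^sub>1 g\<^sub>2. sweedler A h (\<lambda>h\<^sub>1 h\<^sub>2. tens (hspace A) (hspace A) (g\<^sub>1 * h\<^sub>1) (g\<^sub>2 * h\<^sub>2)))"
    and counit_one: "counit A 1 = 1"
    and counit_mult: "counit A (g * h) = counit A g * counit A h"
    and antipode_lin: "lin (hspace A) (hscale A) (antipode A)"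
    and antipode_left: "sweedler A h (\<lambda>h\<^sub>1 h\<^sub>2. antipode A h\<^sub>1 * h\<^sub>2) = hscale A (counit A h) 1"
    and antipode_right: "sweedler A h (\<lambda>h\<^sub>1 h\<^sub>2. h\<^sub>1 * antipode A h\<^sub>2) = hscale A (counit A h) 1"

section \<open>Yetter-Drinfel'd-Long bimodules\<close>

record ('k, 'h, 'm) ydl_data = "('k, 'm) space" +
  lact :: "'h \<Rightarrow> 'm \<Rightarrow> 'm"
  ract :: "'m \<Rightarrow> 'h \<Rightarrow> 'm"
  lcoact :: "'m \<Rightarrow> ('k, 'h, 'm) tensor"
  rcoact :: "'m \<Rightarrow> ('k, 'm, 'h) tensor"

text \<open>
  The Sweedler sum of all \<open>F m\<^sub>[\<^sub>-\<^sub>1\<^sub>] m\<^sub>[\<^sub>0\<^sub>]\<close>, respectively of all \<open>F m\<^sub>(\<^sub>0\<^sub>) m\<^sub>(\<^sub>1\<^sub>)\<close>, for the left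
  and the right coaction.
\<close>

definition lsweedler ::
  "('k::field, 'h::ring_1) hopf \<Rightarrow> ('k, 'h, 'm::ab_group_add) ydl_data \<Rightarrow> 'm \<Rightarrow>
    ('h \<Rightarrow> 'm \<Rightarrow> 'u::comm_monoid_add) \<Rightarrow> 'u" where
  "lsweedler A M m F = tlift (hspace A) M F (lcoact M m)"

definition rsweedler ::
  "('k::field, 'h::ring_1) hopf \<Rightarrow> ('k, 'h, 'm::ab_group_add) ydl_data \<Rightarrow> 'm \<Rightarrow>
    ('m \<Rightarrow> 'h \<Rightarrow> 'u::comm_monoid_add) \<Rightarrow> 'u" where
  "rsweedler A M m F = tlift M (hspace A) F (rcoact M m)"

locale ydl_bimodule = hopf_algebra A
  for A :: "('k::field, 'h::ring_1) hopf" +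
  fixes M :: "('k, 'h, 'm::ab_group_add) ydl_data"
  assumes space: "is_space M"
    and lact_closed: "m \<in> carrier M \<Longrightarrow> lact M h m \<in> carrier M"
    and lact_bilin: "bilin (hspace A) M (scale M) (lact M)"
    and lact_one: "m \<in> carrier M \<Longrightarrow> lact M 1 m = m"
    and lact_mult: "m \<in> carrier M \<Longrightarrow> lact M (g * h) m = lact M g (lact M h m)"
    and ract_closed: "m \<in> carrier M \<Longrightarrow> ract M m h \<in> carrier M"
    and ract_bilin: "bilin M (hspace A) (scale M) (ract M)"
    and ract_one: "m \<in> carrier M \<Longrightarrow> ract M m 1 = m"
    and ract_mult: "m \<in> carrier M \<Longrightarrow> ract M m (g * h) = ract M (ract M m g) h"
    and bimodule: "m \<in> carrier M \<Longrightarrow> ract M (lact M g m) h = lact M g (ract M m h)"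
    and lcoact_closed: "m \<in> carrier M \<Longrightarrow> lcoact M m \<in> carrier (tensor (hspace A) M)"
    and lcoact_lin: "lin M tscale (lcoact M)"
    and lcoact_coassoc: "m \<in> carrier M \<Longrightarrow>
      lsweedler A M m (\<lambda>a n. sweedler A a (\<lambda>a\<^sub>1 a\<^sub>2.
        tens (hspace A) (tensor (hspace A) M) a\<^sub>1 (tens (hspace A) M a\<^sub>2 n))) =
      lsweedler A M m (\<lambda>a n. lsweedler A M n (\<lambda>b p.
        tens (hspace A) (tensor (hspace A) M) a (tens (hspace A) M b p)))"
    and lcoact_counit: "m \<in> carrier M \<Longrightarrow> lsweedler A M m (\<lambda>a n. scale M (counit A a) n) = m"
    and rcoact_closed: "m \<in> carrier M \<Longrightarrow> rcoact M m \<in> carrier (tensor M (hspace A))"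
    and rcoact_lin: "lin M tscale (rcoact M)"
    and rcoact_coassoc: "m \<in> carrier M \<Longrightarrow>
      rsweedler A M m (\<lambda>n a. sweedler A a (\<lambda>a\<^sub>1 a\<^sub>2.
        tens (tensor M (hspace A)) (hspace A) (tens M (hspace A) n a\<^sub>1) a\<^sub>2)) =
      rsweedler A M m (\<lambda>n a. rsweedler A M n (\<lambda>p b.
        tens (tensor M (hspace A)) (hspace A) (tens M (hspace A) p b) a))"
    and rcoact_counit: "m \<in> carrier M \<Longrightarrow> rsweedler A M m (\<lambda>n a. scale M (counit A a) n) = m"
    and bicomodule: "m \<in> carrier M \<Longrightarrow>
      lsweedler A M m (\<lambda>a n. rsweedler A M n (\<lambda>p b.
        tens (hspace A) (tensor M (hspace A)) a (tens M (hspace A) p b))) =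
      rsweedler A M m (\<lambda>n b. lsweedler A M n (\<lambda>a p.
        tens (hspace A) (tensor M (hspace A)) a (tens M (hspace A) p b)))"
    and lact_lcoact: "m \<in> carrier M \<Longrightarrow>
      sweedler A h (\<lambda>h\<^sub>1 h\<^sub>2. lsweedler A M (lact M h\<^sub>1 m) (\<lambda>a n. tens (hspace A) M (a * h\<^sub>2) n)) =
      sweedler A h (\<lambda>h\<^sub>1 h\<^sub>2. lsweedler A M m (\<lambda>a n. tens (hspace A) M (h\<^sub>1 * a) (lact M h\<^sub>2 n)))"
    and lact_rcoact: "m \<in> carrier M \<Longrightarrow>
      rcoact M (lact M h m) = rsweedler A M m (\<lambda>n a. tens M (hspace A) (lact M h n) a)"
    and ract_rcoact: "m \<in> carrier M \<Longrightarrow>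
      sweedler A h (\<lambda>h\<^sub>1 h\<^sub>2. rsweedler A M (ract M m h\<^sub>2) (\<lambda>n a. tens M (hspace A) n (h\<^sub>1 * a))) =
      sweedler A h (\<lambda>h\<^sub>1 h\<^sub>2. rsweedler A M m (\<lambda>n a. tens M (hspace A) (ract M n h\<^sub>1) (a * h\<^sub>2)))"
    and ract_lcoact: "m \<in> carrier M \<Longrightarrow>
      lcoact M (ract M m h) = lsweedler A M m (\<lambda>a n. tens (hspace A) M a (ract M n h))"

text \<open>
  The condition is stated on the raw data; it is applied below to \<open>H1\<close>, ..., \<open>H4\<close>, which satisfy
  \<open>ydl_bimodule\<close> by \<open>ydl_H1\<close>, ..., \<open>ydl_H4\<close>.
\<close>

definition u_condition ::
  "('k::field, 'h::ring_1) hopf \<Rightarrow> ('k, 'h, 'm::ab_group_add) ydl_data \<Rightarrow> bool" where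
  "u_condition A M \<longleftrightarrow>
    (\<forall>m\<in>carrier M. lsweedler A M m (\<lambda>a n. rsweedler A M n (\<lambda>p b. ract M (lact M a p) b)) = m)"

section \<open>The four structures on \<open>H \<otimes> H\<close>\<close>

text \<open>\<open>on_HH A F\<close> is the linear map on \<open>H \<otimes> H\<close> with \<open>k \<otimes> l \<mapsto> F k l\<close>.\<close>

abbreviation HH :: "('k::field, 'h::ring_1) hopf \<Rightarrow> ('k, ('k, 'h, 'h) tensor) space" where
  "HH A \<equiv> tensor (hspace A) (hspace A)"

abbreviation pure :: "('k::field, 'h::ring_1) hopf \<Rightarrow> 'h \<Rightarrow> 'h \<Rightarrow> ('k, 'h, 'h) tensor" where
  "pure A k l \<equiv> tens (hspace A) (hspace A) k l"

abbreviation on_HH ::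
  "('k::field, 'h::ring_1) hopf \<Rightarrow> ('h \<Rightarrow> 'h \<Rightarrow> 'u::comm_monoid_add) \<Rightarrow> ('k, 'h, 'h) tensor \<Rightarrow> 'u"
  where
  "on_HH A F \<equiv> tlift (hspace A) (hspace A) F"

definition H1 :: "('k::field, 'h::ring_1) hopf \<Rightarrow> ('k, 'h, ('k, 'h, 'h) tensor) ydl_data" where
  "H1 A = \<lparr>carrier = carrier (HH A), scale = scale (HH A),
    lact = (\<lambda>h. on_HH A (\<lambda>k l. pure A (h * k) l)),
    ract = (\<lambda>x h. on_HH A (\<lambda>k l. sweedler A h (\<lambda>h\<^sub>1 h\<^sub>2. pure A k (antipode A h\<^sub>1 * l * h\<^sub>2))) x),
    lcoact = on_HH A (\<lambda>k l. sweedler3 A k (\<lambda>k\<^sub>1 k\<^sub>2 k\<^sub>3.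
      tens (hspace A) (HH A) (k\<^sub>1 * antipode A k\<^sub>3) (pure A k\<^sub>2 l))),
    rcoact = on_HH A (\<lambda>k l. sweedler A l (\<lambda>l\<^sub>1 l\<^sub>2. tens (HH A) (hspace A) (pure A k l\<^sub>1) l\<^sub>2))\<rparr>"

definition H2 :: "('k::field, 'h::ring_1) hopf \<Rightarrow> ('k, 'h, ('k, 'h, 'h) tensor) ydl_data" where
  "H2 A = \<lparr>carrier = carrier (HH A), scale = scale (HH A),
    lact = (\<lambda>h. on_HH A (\<lambda>k l. sweedler A h (\<lambda>h\<^sub>1 h\<^sub>2. pure A (h\<^sub>1 * k * antipode A h\<^sub>2) l))),
    ract = (\<lambda>x h. on_HH A (\<lambda>k l. pure A k (l * h)) x),
    lcoact = on_HH A (\<lambda>k l. sweedler A k (\<lambda>k\<^sub>1 k\<^sub>2. tens (hspace A) (HH A) k\<^sub>1 (pure A k\<^sub>2 l))),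
    rcoact = on_HH A (\<lambda>k l. sweedler3 A l (\<lambda>l\<^sub>1 l\<^sub>2 l\<^sub>3.
      tens (HH A) (hspace A) (pure A k l\<^sub>2) (antipode A l\<^sub>1 * l\<^sub>3)))\<rparr>"

definition H3 :: "('k::field, 'h::ring_1) hopf \<Rightarrow> ('k, 'h, ('k, 'h, 'h) tensor) ydl_data" where
  "H3 A = \<lparr>carrier = carrier (HH A), scale = scale (HH A),
    lact = (\<lambda>h. on_HH A (\<lambda>k l. pure A (h * k) l)),
    ract = (\<lambda>x h. on_HH A (\<lambda>k l. pure A k (l * h)) x),
    lcoact = on_HH A (\<lambda>k l. sweedler3 A k (\<lambda>k\<^sub>1 k\<^sub>2 k\<^sub>3.
      tens (hspace A) (HH A) (k\<^sub>1 * antipode A k\<^sub>3) (pure A k\<^sub>2 l))),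
    rcoact = on_HH A (\<lambda>k l. sweedler3 A l (\<lambda>l\<^sub>1 l\<^sub>2 l\<^sub>3.
      tens (HH A) (hspace A) (pure A k l\<^sub>2) (antipode A l\<^sub>1 * l\<^sub>3)))\<rparr>"

definition H4 :: "('k::field, 'h::ring_1) hopf \<Rightarrow> ('k, 'h, ('k, 'h, 'h) tensor) ydl_data" where
  "H4 A = \<lparr>carrier = carrier (HH A), scale = scale (HH A),
    lact = (\<lambda>h. on_HH A (\<lambda>k l. sweedler A h (\<lambda>h\<^sub>1 h\<^sub>2. pure A (h\<^sub>1 * k * antipode A h\<^sub>2) l))),
    ract = (\<lambda>x h. on_HH A (\<lambda>k l. sweedler A h (\<lambda>h\<^sub>1 h\<^sub>2. pure A k (antipode A h\<^sub>1 * l * h\<^sub>2))) x),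
    lcoact = on_HH A (\<lambda>k l. sweedler A k (\<lambda>k\<^sub>1 k\<^sub>2. tens (hspace A) (HH A) k\<^sub>1 (pure A k\<^sub>2 l))),
    rcoact = on_HH A (\<lambda>k l. sweedler A l (\<lambda>l\<^sub>1 l\<^sub>2. tens (HH A) (hspace A) (pure A k l\<^sub>1) l\<^sub>2))\<rparr>"

section \<open>The four structures are Yetter-Drinfel'd-Long bimodules\<close>

named_theorems lin

lemma linI:
  assumes "\<And>x y. x \<in> carrier V \<Longrightarrow> y \<in> carrier V \<Longrightarrow> f (x + y) = f x + f y"
    and "\<And>c x. x \<in> carrier V \<Longrightarrow> f (scale V c x) = s c (f x)"
  shows "lin V s f"
  using assms by (simp add: lin_def)

lemma lin_id: "scale V = s \<Longrightarrow> lin V s (\<lambda>x. x)"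
  by (auto simp: lin_def)

lemma bilinI [lin]:
  assumes "\<And>w. w \<in> carrier W \<Longrightarrow> lin V s (\<lambda>v. F v w)" "\<And>v. v \<in> carrier V \<Longrightarrow> lin W s (\<lambda>w. F v w)"
  shows "bilin V W s F"
  using assms by (simp add: bilin_def)

lemma lin_tlift_arg [lin]:
  assumes "is_space V" "is_space W" "vector_space s" "bilin V W s F"
    "\<And>x. x \<in> carrier X \<Longrightarrow> f x \<in> carrier (tensor V W)" "lin X tscale f"
  shows "lin X s (\<lambda>x. tlift V W F (f x))"
  using lin_tlift[OF assms(1-4)] assms(5,6) by (auto simp: lin_def)

lemma lin_tlift_fun [lin]:
  assumes "vector_space s" "y \<in> carrier (tensor V W)"
    "\<And>v w. v \<in> carrier V \<Longrightarrow> w \<in> carrier W \<Longrightarrow> lin X s (\<lambda>x. F x v w)"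
  shows "lin X s (\<lambda>x. tlift V W (F x) y)"
proof -
  interpret vector_space s by fact
  have "lin X s (\<lambda>x. lsum (F x) ps)" if "set ps \<subseteq> carrier V \<times> carrier W" for ps
    using that
  proof (induction ps)
    case Nil
    show ?case by (auto simp: lin_def)
  next
    case (Cons p ps)
    then have "lin X s (\<lambda>x. F x (fst p) (snd p))" "lin X s (\<lambda>x. lsum (F x) ps)"
      using assms(3) by auto
    then show ?case by (auto simp: lin_def scale_right_distrib algebra_simps)
  qed
  then show ?thesis using tensor_rep(1)[OF assms(2)] by (simp add: tlift_def)
qed

lemma lin_tens_left:
  assumes "is_space V" "is_space W" "w \<in> carrier W"
    "\<And>x. x \<in> carrier X \<Longrightarrow> f x \<in> carrier V" "scale V = s" "lin X s f"
  shows "lin X tscale (\<lambda>x. tens V W (f x) w)"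
  using bilin_tens[OF assms(1,2)] assms(3-) by (auto simp: lin_def bilin_def)

lemma lin_tens_right:
  assumes "is_space V" "is_space W" "v \<in> carrier V"
    "\<And>x. x \<in> carrier X \<Longrightarrow> f x \<in> carrier W" "scale W = s" "lin X s f"
  shows "lin X tscale (\<lambda>x. tens V W v (f x))"
  using bilin_tens[OF assms(1,2)] assms(3-) by (auto simp: lin_def bilin_def)

lemma tlift_closed:
  assumes "is_space U" "x \<in> carrier (tensor V W)"
    "\<And>v w. v \<in> carrier V \<Longrightarrow> w \<in> carrier W \<Longrightarrow> F v w \<in> carrier U"
  shows "tlift V W F x \<in> carrier U"
  unfolding tlift_def using tensor_rep(1)[OF assms(2)] by (intro lsum_carrier assms(1,3)) auto

lemma tlift_lin:
  assumes "is_space U" "lin U s f" "x \<in> carrier (tensor V W)"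
    "\<And>v w. v \<in> carrier V \<Longrightarrow> w \<in> carrier W \<Longrightarrow> F v w \<in> carrier U"
  shows "f (tlift V W F x) = tlift V W (\<lambda>v w. f (F v w)) x"
  unfolding tlift_def using tensor_rep(1)[OF assms(3)]
  by (intro lin_lsum[OF assms(1,2)] assms(4)) auto

lemma tlift_swap:
  "tlift V W (\<lambda>v w. tlift V' W' (F v w) y) x = tlift V' W' (\<lambda>a b. tlift V W (\<lambda>v w. F v w a b) x) y"
  unfolding tlift_def by (rule lsum_swap)

lemma space_cong:
  assumes "carrier V = carrier V'" "scale V = scale V'" "carrier W = carrier W'" "scale W = scale W'"
  shows "tens V W = tens V' W'" "tensor V W = tensor V' W'" "tlift V W F = tlift V' W' F"
proof -
  have "bilin V W (*) F = bilin V' W' (*) F" for F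
    by (simp add: bilin_def lin_def assms)
  then show *: "tens V W = tens V' W'"
    by (intro ext) (simp add: functional_of_inject[symmetric] tens.rep_eq)
  show "tensor V W = tensor V' W'" "tlift V W F = tlift V' W' F"
    by (auto simp: tensor_def tlift_def tensor_rep_def * assms)
qed

declare vector_space_tscale [lin] tens_in_tensor [lin] is_space_tensor [lin]
  tlift_closed [lin]

context hopf_algebra
begin

abbreviation "H \<equiv> hspace A"
abbreviation "sc \<equiv> hscale A"
abbreviation "S \<equiv> antipode A"
abbreviation "e \<equiv> counit A"
abbreviation "sw \<equiv> sweedler A"
abbreviation "T3 a b c \<equiv> tens H (HH A) a (tens H H b c)"

definition gsw :: "('h \<Rightarrow> ('k, 'h, 'h) tensor) \<Rightarrow> 'h \<Rightarrow> ('h \<Rightarrow> 'h \<Rightarrow> 'u::comm_monoid_add) \<Rightarrow> 'u"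
  where "gsw c h F = tlift H H F (c h)"

definition cmap :: "('h \<Rightarrow> ('k, 'h, 'h) tensor) \<Rightarrow> bool" where
  "cmap c \<longleftrightarrow> (\<forall>h. c h \<in> carrier (HH A)) \<and> lin H tscale c"

lemma sw_gsw: "sw = gsw (comul A)"
  by (simp add: fun_eq_iff gsw_def sweedler_def)

lemma carrier_H [simp]: "carrier H = UNIV" and scale_H [simp]: "scale H = sc"
  by (simp_all add: hspace_def)

lemma in_H [lin]: "x \<in> carrier H" by simp

lemma space_H [lin]: "is_space H"
  using hscale_vector_space by (simp add: is_space_def module.subspace_def vector_space_def module_def)

declare hscale_vector_space [lin]

sublocale vs: vector_space sc by (rule hscale_vector_space)

lemma lin_H: "lin H s f \<longleftrightarrow> (\<forall>x y. f (x + y) = f x + f y) \<and> (\<forall>c x. f (sc c x) = s c (f x))"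
  by (simp add: lin_def)

lemmas [lin] =
  lin_id[OF scale_H] lin_id[OF scale_tensor]
  lin_tens_left[OF _ _ _ _ scale_H] lin_tens_left[OF _ _ _ _ scale_tensor]
  lin_tens_right[OF _ _ _ _ scale_H] lin_tens_right[OF _ _ _ _ scale_tensor]

lemma lin_comp: "lin H s f \<Longrightarrow> lin X sc g \<Longrightarrow> lin X s (\<lambda>x. f (g x))"
  by (auto simp: lin_def)

lemma lin_mult_left [lin]: "lin X sc f \<Longrightarrow> lin X sc (\<lambda>x. f x * y)"
  by (auto simp: lin_def distrib_right hscale_mult_left)

lemma lin_mult_right [lin]: "lin X sc f \<Longrightarrow> lin X sc (\<lambda>x. y * f x)"
  by (auto simp: lin_def distrib_left hscale_mult_right)

lemma lin_S [lin]: "lin X sc f \<Longrightarrow> lin X sc (\<lambda>x. S (f x))"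
  using antipode_lin by (auto simp: lin_def)

lemma lin_comul [lin]: "lin X sc f \<Longrightarrow> lin X tscale (\<lambda>x. comul A (f x))"
  using comul_lin by (auto simp: lin_def)

lemma lin_scale_e [lin]: "vector_space s \<Longrightarrow> lin X sc f \<Longrightarrow> lin X s (\<lambda>x. s (e (f x)) y)"
  using counit_lin
  by (auto simp: lin_def vector_space_def)

lemma lin_scale [lin]: "vector_space s \<Longrightarrow> lin X s f \<Longrightarrow> lin X s (\<lambda>x. s c (f x))"
  by (auto simp: lin_def vector_space_def mult.commute)

lemma cmap_comul [lin]: "cmap (comul A)"
  using comul_closed comul_lin by (simp add: cmap_def)

lemma lin_gsw_arg:
  assumes "cmap c" "vector_space s" "\<And>b. lin H s (\<lambda>a. F a b)" "\<And>a. lin H s (\<lambda>b. F a b)" "lin X sc f"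
  shows "lin X s (\<lambda>x. gsw c (f x) F)"
  unfolding gsw_def
  using assms(1,5) by (intro lin assms) (auto simp: cmap_def lin_def)

lemma lin_gsw_fun:
  assumes "cmap c" "vector_space s" "\<And>a b. lin X s (\<lambda>x. F x a b)"
  shows "lin X s (\<lambda>x. gsw c y (F x))"
  unfolding gsw_def using assms(1) by (intro lin assms) (auto simp: cmap_def)

lemma gsw_closed:
  assumes "cmap c" "is_space U" "\<And>a b. F a b \<in> carrier U"
  shows "gsw c y F \<in> carrier U"
  unfolding gsw_def using assms by (intro lin) (auto simp: cmap_def)

lemmas [lin] = lin_gsw_arg lin_gsw_fun gsw_closed
  lin_gsw_arg[OF cmap_comul, folded sw_gsw] lin_gsw_fun[OF cmap_comul, folded sw_gsw]
  gsw_closed[OF cmap_comul, folded sw_gsw]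

lemma gsw_lin:
  assumes "cmap c" "is_space U" "lin U s f" "\<And>a b. F a b \<in> carrier U"
  shows "f (gsw c h F) = gsw c h (\<lambda>a b. f (F a b))"
  unfolding gsw_def using assms by (intro tlift_lin[OF assms(2,3)]) (auto simp: cmap_def)

lemma gsw_lin_H: "cmap c \<Longrightarrow> lin H s f \<Longrightarrow> f (gsw c h F) = gsw c h (\<lambda>a b. f (F a b))"
  by (rule gsw_lin[OF _ space_H]) simp_all

lemmas sw_lin = gsw_lin[OF cmap_comul, folded sw_gsw]
lemmas sw_lin_H = gsw_lin_H[OF cmap_comul, folded sw_gsw]

lemma gsw_swap: "gsw c g (\<lambda>a b. gsw d h (F a b)) = gsw d h (\<lambda>x y. gsw c g (\<lambda>a b. F a b x y))"
  unfolding gsw_def by (rule tlift_swap)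

lemmas sw_swap = gsw_swap[of "comul A" _ "comul A", folded sw_gsw]

lemma gsw_cong: "(\<And>a b. F a b = G a b) \<Longrightarrow> gsw c h F = gsw c h G"
  by presburger

lemmas sw_cong = gsw_cong[of _ _ "comul A", folded sw_gsw]

lemma gsw_transfer:
  assumes s: "vector_space s"
    and F: "\<And>b c. lin H s (\<lambda>a. F a b c)" "\<And>a c. lin H s (\<lambda>b. F a b c)" "\<And>a b. lin H s (\<lambda>c. F a b c)"
  obtains \<phi> where "lin (tensor H (HH A)) s \<phi>" "\<And>a b c. \<phi> (T3 a b c) = F a b c"
proof
  let ?G = "\<lambda>a x. tlift H H (F a) x"
  have bil: "bilin H H s (F a)" for a
    by (intro lin F)
  have bil2: "bilin H (HH A) s ?G"
    by (intro lin bil s F) simp_all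
  show "lin (tensor H (HH A)) s (tlift H (HH A) ?G)"
    by (intro lin bil2 s) 
  show "tlift H (HH A) ?G (T3 a b c) = F a b c" for a b c
    by (subst tlift_tens[OF s bil2]) (auto simp: tlift_tens[OF s bil] intro!: lin)
qed

lemma transfer2:
  assumes s: "vector_space s"
    and F: "\<And>b. lin H s (\<lambda>a. F a b)" "\<And>a. lin H s (\<lambda>b. F a b)"
  obtains \<phi> where "lin (HH A) s \<phi>" "\<And>a b. \<phi> (tens H H a b) = F a b"
proof
  have bil: "bilin H H s F"
    by (intro lin F)
  show "lin (HH A) s (tlift H H F)"
    by (intro lin bil s) 
  show "tlift H H F (tens H H a b) = F a b" for a b
    by (subst tlift_tens[OF s bil]) auto
qed

lemma sw_coassoc:
  assumes s: "vector_space s"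
    and F: "\<And>b c. lin H s (\<lambda>a. F a b c)" "\<And>a c. lin H s (\<lambda>b. F a b c)" "\<And>a b. lin H s (\<lambda>c. F a b c)"
  shows "sw h (\<lambda>a b. sw a (\<lambda>x y. F x y b)) = sw h (\<lambda>a b. sw b (\<lambda>x y. F a x y))"
proof -
  obtain \<phi> where \<phi>: "lin (tensor H (HH A)) s \<phi>" "\<And>a b c. \<phi> (T3 a b c) = F a b c"
    using gsw_transfer[of s F] s F by blast
  have "\<phi> (sw h (\<lambda>a b. sw a (\<lambda>x y. T3 x y b))) = \<phi> (sw h (\<lambda>a b. sw b (\<lambda>x y. T3 a x y)))"
    by (simp only: comul_coassoc)
  moreover have "\<phi> (sw h (\<lambda>a b. sw a (\<lambda>x y. T3 x y b))) = sw h (\<lambda>a b. sw a (\<lambda>x y. F x y b))"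
    by (subst sw_lin[OF _ \<phi>(1)], (intro lin)+)
      (subst sw_lin[OF _ \<phi>(1)], (intro lin)+, simp add: \<phi>(2))
  moreover have "\<phi> (sw h (\<lambda>a b. sw b (\<lambda>x y. T3 a x y))) = sw h (\<lambda>a b. sw b (\<lambda>x y. F a x y))"
    by (subst sw_lin[OF _ \<phi>(1)], (intro lin)+)
      (subst sw_lin[OF _ \<phi>(1)], (intro lin)+, simp add: \<phi>(2))
  ultimately show ?thesis by simp
qed

lemma sw_counit_left: "lin H s f \<Longrightarrow> sw h (\<lambda>a b. s (e a) (f b)) = f h"
  using sw_lin_H[of s f h "\<lambda>a b. sc (e a) b"] counit_left[of h] by (simp add: lin_H)

lemma sw_counit_right: "lin H s f \<Longrightarrow> sw h (\<lambda>a b. s (e b) (f a)) = f h"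
  using sw_lin_H[of s f h "\<lambda>a b. sc (e b) a"] counit_right[of h] by (simp add: lin_H)

lemma sw_S_left: "lin H s f \<Longrightarrow> sw h (\<lambda>a b. f (S a * b)) = s (e h) (f 1)"
  using sw_lin_H[of s f h "\<lambda>a b. S a * b"] antipode_left[of h] by (simp add: lin_H)

lemma sw_S_right: "lin H s f \<Longrightarrow> sw h (\<lambda>a b. f (a * S b)) = s (e h) (f 1)"
  using sw_lin_H[of s f h "\<lambda>a b. a * S b"] antipode_right[of h] by (simp add: lin_H)

lemma sw_mult:
  assumes s: "vector_space s"
    and F: "\<And>b. lin H s (\<lambda>a. F a b)" "\<And>a. lin H s (\<lambda>b. F a b)"
  shows "sw (g * h) F = sw g (\<lambda>a b. sw h (\<lambda>c d. F (a * c) (b * d)))"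
proof -
  have bil: "bilin H H s F" by (intro lin F)
  have l: "lin (HH A) s (tlift H H F)" by (intro lin bil s)
  have "sw (g * h) F = tlift H H F (sw g (\<lambda>a b. sw h (\<lambda>c d. tens H H (a * c) (b * d))))"
    by (simp add: sweedler_def[of A "g * h"] comul_mult)
  also have "\<dots> = sw g (\<lambda>a b. sw h (\<lambda>c d. F (a * c) (b * d)))"
    by (subst sw_lin[OF _ l], (intro lin)+)
      (subst sw_lin[OF _ l], (intro lin)+, simp add: tlift_tens[OF s bil])
  finally show ?thesis .
qed

lemma sw_one:
  assumes s: "vector_space s"
    and F: "\<And>b. lin H s (\<lambda>a. F a b)" "\<And>a. lin H s (\<lambda>b. F a b)"
  shows "sw 1 F = F 1 1"
proof -
  have bil: "bilin H H s F" by (intro lin F)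
  show ?thesis by (simp add: sweedler_def comul_one tlift_tens[OF s bil])
qed

lemma S_one: "S 1 = 1"
proof -
  have "sw 1 (\<lambda>a b. S a * b) = S 1"
    by (subst sw_one[of sc], (intro lin)+, simp_all)
  then show ?thesis by (simp add: antipode_left counit_one)
qed

lemma e_S: "e (S h) = e h"
proof -
  have *: "e (sc c x) = c * e x" for c x
    using counit_lin by (simp add: lin_H)
  have "e h = e (sw h (\<lambda>a b. S a * b))"
    by (simp add: antipode_left * counit_one)
  also have "\<dots> = sw h (\<lambda>a b. e b * e (S a))"
    by (subst sw_lin_H[OF counit_lin]) (simp add: counit_mult mult.commute)
  also have "\<dots> = e (S h)"
    using antipode_lin counit_lin by (intro sw_counit_right) (auto simp: lin_H)
  finally show ?thesis by simp
qed

lemma S_mult: "S (g * h) = S h * S g"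
proof -
  let ?Q = "\<lambda>a u v c x y. S (a * c) * (u * x) * (S y * S v)"
  let ?X = "sw g (\<lambda>a b. sw h (\<lambda>c d. sw b (\<lambda>u v. sw d (\<lambda>x y. ?Q a u v c x y))))"
  have "sw d (\<lambda>x y. ?Q a u v c x y) = sc (e d) (S (a * c) * (u * S v))" for a c d u v
  proof -
    have "lin H sc (\<lambda>z. S (a * c) * (u * z * S v))" by (intro lin)
    from sw_S_right[OF this] show ?thesis by (simp add: mult.assoc)
  qed
  moreover have "sw b (\<lambda>u v. sc (e d) (S (a * c) * (u * S v))) = sc (e d) (sc (e b) (S (a * c)))" for a b c d
  proof -
    have "lin H sc (\<lambda>z. sc (e d) (S (a * c) * z))" by (intro lin)
    from sw_S_right[OF this] show ?thesis by (simp add: vs.scale_left_commute)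
  qed
  moreover have "sw h (\<lambda>c d. sc (e d) (sc (e b) (S (a * c)))) = sc (e b) (S (a * h))" for a b
    by (rule sw_counit_right) (intro lin)
  moreover have "sw g (\<lambda>a b. sc (e b) (S (a * h))) = S (g * h)"
    by (rule sw_counit_right) (intro lin)
  ultimately have 1: "?X = S (g * h)" by simp
  have "?X = sw g (\<lambda>a b. sw b (\<lambda>u v. sw h (\<lambda>c d. sw d (\<lambda>x y. ?Q a u v c x y))))"
    by (subst sw_swap) simp
  also have "\<dots> = sw g (\<lambda>m v. sw m (\<lambda>a u. sw h (\<lambda>c d. sw d (\<lambda>x y. ?Q a u v c x y))))"
    by (rule sw_coassoc[of sc, symmetric]) (intro lin)+
  also have "\<dots> = sw g (\<lambda>m v. sw m (\<lambda>a u. sw h (\<lambda>n y. sw n (\<lambda>c x. ?Q a u v c x y))))"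
    by (rule sw_cong, rule sw_cong, rule sw_coassoc[of sc, symmetric]) (intro lin)+
  also have "\<dots> = sw g (\<lambda>m v. sw h (\<lambda>n y. sw m (\<lambda>a u. sw n (\<lambda>c x. ?Q a u v c x y))))"
    by (subst sw_swap) simp
  also have "\<dots> = sw g (\<lambda>m v. sw h (\<lambda>n y. sc (e n) (sc (e m) (S y * S v))))"
  proof -
    have "sw m (\<lambda>a u. sw n (\<lambda>c x. ?Q a u v c x y)) = sw (m * n) (\<lambda>p q. S p * q * (S y * S v))" for m n v y
      by (rule sw_mult[of sc, symmetric]) (intro lin)+
    moreover have "sw (m * n) (\<lambda>p q. S p * q * (S y * S v)) = sc (e (m * n)) (1 * (S y * S v))" for m n v y
      by (rule sw_S_left) (intro lin)
    ultimately show ?thesis by (simp add: counit_mult mult.commute)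
  qed
  also have "\<dots> = sw g (\<lambda>m v. sc (e m) (S h * S v))"
    by (subst sw_counit_left[of sc]) (intro lin, simp)
  also have "\<dots> = S h * S g"
    by (rule sw_counit_left) (intro lin)
  finally show ?thesis using 1 by simp
qed

lemma comul_S: "comul A (S h) = sw h (\<lambda>a b. tens H H (S b) (S a))"
proof -
  let ?K = "\<lambda>p q r s u v. tens H H (p * (r * S v)) (q * (s * S u))"
  let ?X = "sw h (\<lambda>a b. sw (S a) (\<lambda>p q. sw b (\<lambda>c d. sw c (\<lambda>r s. sw d (\<lambda>u v. ?K p q r s u v)))))"
  have "sw b (\<lambda>c d. sw c (\<lambda>r s. sw d (\<lambda>u v. ?K p q r s u v))) = tscale (e b) (tens H H p q)" for b p q
  proof -
    have "sw b (\<lambda>c d. sw c (\<lambda>r s. sw d (\<lambda>u v. ?K p q r s u v))) =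
        sw b (\<lambda>r t. sw t (\<lambda>s d. sw d (\<lambda>u v. ?K p q r s u v)))"
      by (rule sw_coassoc[of tscale]) (intro lin)+
    also have "\<dots> = sw b (\<lambda>r t. sw t (\<lambda>m v. sw m (\<lambda>s u. ?K p q r s u v)))"
      by (rule sw_cong, rule sw_coassoc[of tscale, symmetric]) (intro lin)+
    also have "\<dots> = sw b (\<lambda>r t. sw t (\<lambda>m v. tscale (e m) (tens H H (p * (r * S v)) (q * 1))))"
      by (subst sw_S_right[of tscale]) (intro lin, simp)
    also have "\<dots> = sw b (\<lambda>r t. tens H H (p * (r * S t)) (q * 1))"
      by (subst sw_counit_left[of tscale]) (intro lin, simp)
    also have "\<dots> = tscale (e b) (tens H H (p * 1) (q * 1))"
      by (rule sw_S_right) (intro lin)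
    finally show ?thesis by simp
  qed
  then have "?X = sw h (\<lambda>a b. sw (S a) (\<lambda>p q. tscale (e b) (tens H H p q)))"
    by simp
  also have "\<dots> = sw h (\<lambda>a b. tscale (e b) (comul A (S a)))"
  proof -
    have "sw k (\<lambda>p q. tscale c (tens H H p q)) = tscale c (comul A k)" for k c
    proof -
      have "lin (HH A) tscale (\<lambda>x. tscale c x)" by (intro lin)
      then have "tscale c (comul A k) = tlift H H (\<lambda>p q. tscale c (tens H H p q)) (comul A k)"
        by (rule lin_on_tensor[OF space_H space_H _ comul_closed])
      then show ?thesis by (simp add: sweedler_def)
    qed
    then show ?thesis by simp
  qed
  also have "\<dots> = comul A (S h)"
    by (rule sw_counit_right) (intro lin)
  finally have 1: "?X = comul A (S h)" .
  let ?W = "\<lambda>d x y. sw d (\<lambda>u v. tens H H (x * S v) (y * S u))"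
  have "?X = sw h (\<lambda>a b. sw b (\<lambda>c d. sw (S a) (\<lambda>p q. sw c (\<lambda>r s. ?W d (p * r) (q * s)))))"
    by (subst sw_swap) (simp add: mult.assoc)
  also have "\<dots> = sw h (\<lambda>m d. sw m (\<lambda>a c. sw (S a) (\<lambda>p q. sw c (\<lambda>r s. ?W d (p * r) (q * s)))))"
    by (rule sw_coassoc[of tscale, symmetric]) (intro lin)+
  also have "\<dots> = sw h (\<lambda>m d. sw m (\<lambda>a c. sw (S a * c) (?W d)))"
    by (rule sw_cong, rule sw_cong, rule sw_mult[of tscale, symmetric]) (intro lin)+
  also have "\<dots> = sw h (\<lambda>m d. tscale (e m) (sw 1 (?W d)))"
    by (subst sw_S_left[of tscale]) (intro lin, simp)
  also have "\<dots> = sw h (\<lambda>m d. tscale (e m) (?W d 1 1))"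
    by (subst sw_one[of tscale], (intro lin)+) (rule refl)
  also have "\<dots> = ?W h 1 1"
    by (rule sw_counit_left) (intro lin)
  finally show ?thesis using 1 by simp
qed

lemma sw_S:
  assumes s: "vector_space s"
    and F: "\<And>b. lin H s (\<lambda>a. F a b)" "\<And>a. lin H s (\<lambda>b. F a b)"
  shows "sw (S h) F = sw h (\<lambda>a b. F (S b) (S a))"
proof -
  have bil: "bilin H H s F" by (intro lin F)
  have l: "lin (HH A) s (tlift H H F)" by (intro lin bil s)
  have "sw (S h) F = tlift H H F (sw h (\<lambda>a b. tens H H (S b) (S a)))"
    by (simp add: sweedler_def[of A "S h"] comul_S)
  also have "\<dots> = sw h (\<lambda>a b. F (S b) (S a))"
    by (subst sw_lin[OF _ l], (intro lin)+) (simp add: tlift_tens[OF s bil])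
  finally show ?thesis .
qed

lemma push2:
  assumes "lin (HH A) s \<phi>" "\<And>a b. \<phi> (tens H H a b) = F a b" "cmap c" "cmap d"
  shows "\<phi> (gsw c h (\<lambda>a b. gsw d (g a b) (\<lambda>x y. tens H H (p a b x y) (q a b x y)))) =
    gsw c h (\<lambda>a b. gsw d (g a b) (\<lambda>x y. F (p a b x y) (q a b x y)))"
  by (subst gsw_lin[OF assms(3) _ assms(1)], (intro lin assms)+)
    (subst gsw_lin[OF assms(4) _ assms(1)], (intro lin assms)+, simp add: assms)

lemma push3:
  assumes "lin (tensor H (HH A)) s \<phi>" "\<And>a b c. \<phi> (T3 a b c) = F a b c" "cmap c" "cmap d"
  shows "\<phi> (gsw c h (\<lambda>a b. gsw d (g a b) (\<lambda>x y. T3 (p a b x y) (q a b x y) (r a b x y)))) =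
    gsw c h (\<lambda>a b. gsw d (g a b) (\<lambda>x y. F (p a b x y) (q a b x y) (r a b x y)))"
  by (subst gsw_lin[OF assms(3) _ assms(1)], (intro lin assms)+)
    (subst gsw_lin[OF assms(4) _ assms(1)], (intro lin assms)+, simp add: assms)

end

locale left_yd = hopf_algebra A for A :: "('k::field, 'h::ring_1) hopf" +
  fixes la :: "'h \<Rightarrow> 'h \<Rightarrow> 'h" and cl :: "'h \<Rightarrow> ('k, 'h, 'h) tensor"
  assumes la_lin1: "\<And>k. lin H sc (\<lambda>h. la h k)" and la_lin2: "\<And>h. lin H sc (\<lambda>k. la h k)"
    and la_one: "la 1 k = k"
    and la_mult: "la (g * h) k = la g (la h k)"
    and cmap_cl: "cmap cl"
    and cl_coassoc: "gsw cl k (\<lambda>a b. sw a (\<lambda>x y. T3 x y b)) = gsw cl k (\<lambda>a b. gsw cl b (\<lambda>x y. T3 a x y))"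
    and cl_counit: "gsw cl k (\<lambda>a b. sc (e a) b) = k"
    and cl_yd: "sw h (\<lambda>x y. gsw cl (la x k) (\<lambda>a b. tens H H (a * y) b)) =
      sw h (\<lambda>x y. gsw cl k (\<lambda>a b. tens H H (x * a) (la y b)))"
begin

lemma la_lin1': "lin X sc f \<Longrightarrow> lin X sc (\<lambda>x. la (f x) k)"
  using la_lin1 by (auto simp: lin_def)

lemma la_lin2': "lin X sc f \<Longrightarrow> lin X sc (\<lambda>x. la h (f x))"
  using la_lin2 by (auto simp: lin_def)

lemmas [lin] = cmap_cl la_lin1' la_lin2'

lemma cl_coassoc':
  assumes s: "vector_space s"
    and F: "\<And>b c. lin H s (\<lambda>a. F a b c)" "\<And>a c. lin H s (\<lambda>b. F a b c)" "\<And>a b. lin H s (\<lambda>c. F a b c)"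
  shows "gsw cl k (\<lambda>a b. sw a (\<lambda>x y. F x y b)) = gsw cl k (\<lambda>a b. gsw cl b (\<lambda>x y. F a x y))"
proof -
  obtain \<phi> where \<phi>: "lin (tensor H (HH A)) s \<phi>" "\<And>a b c. \<phi> (T3 a b c) = F a b c"
    using gsw_transfer[of s F] s F by blast
  have "\<phi> (gsw cl k (\<lambda>a b. sw a (\<lambda>x y. T3 x y b))) = \<phi> (gsw cl k (\<lambda>a b. gsw cl b (\<lambda>x y. T3 a x y)))"
    by (simp only: cl_coassoc)
  then show ?thesis
    unfolding sw_gsw push3[OF \<phi> cmap_cl cmap_cl] push3[OF \<phi> cmap_cl cmap_comul] .
qed

lemma cl_counit': "lin H s f \<Longrightarrow> gsw cl k (\<lambda>a b. s (e a) (f b)) = f k"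
  using gsw_lin_H[OF cmap_cl, of s f k "\<lambda>a b. sc (e a) b"] cl_counit[of k] by (simp add: lin_H)

lemma cl_yd':
  assumes s: "vector_space s"
    and F: "\<And>b. lin H s (\<lambda>a. F a b)" "\<And>a. lin H s (\<lambda>b. F a b)"
  shows "sw h (\<lambda>x y. gsw cl (la x k) (\<lambda>a b. F (a * y) b)) = sw h (\<lambda>x y. gsw cl k (\<lambda>a b. F (x * a) (la y b)))"
proof -
  obtain \<phi> where \<phi>: "lin (HH A) s \<phi>" "\<And>a b. \<phi> (tens H H a b) = F a b"
    using transfer2[of s F] s F by blast
  have "\<phi> (sw h (\<lambda>x y. gsw cl (la x k) (\<lambda>a b. tens H H (a * y) b))) =
      \<phi> (sw h (\<lambda>x y. gsw cl k (\<lambda>a b. tens H H (x * a) (la y b))))"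
    by (simp only: cl_yd)
  then show ?thesis
    unfolding sw_gsw push2[OF \<phi> cmap_comul cmap_cl] .
qed

end

locale right_yd = hopf_algebra A for A :: "('k::field, 'h::ring_1) hopf" +
  fixes ra :: "'h \<Rightarrow> 'h \<Rightarrow> 'h" and cr :: "'h \<Rightarrow> ('k, 'h, 'h) tensor"
  assumes ra_lin1: "\<And>h. lin H sc (\<lambda>l. ra l h)" and ra_lin2: "\<And>l. lin H sc (\<lambda>h. ra l h)"
    and ra_one: "ra l 1 = l"
    and ra_mult: "ra l (g * h) = ra (ra l g) h"
    and cmap_cr: "cmap cr"
    and cr_coassoc: "gsw cr l (\<lambda>n a. sw a (\<lambda>x y. T3 n x y)) = gsw cr l (\<lambda>n a. gsw cr n (\<lambda>x y. T3 x y a))"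
    and cr_counit: "gsw cr l (\<lambda>n a. sc (e a) n) = l"
    and cr_yd: "sw h (\<lambda>x y. gsw cr (ra l y) (\<lambda>n a. tens H H n (x * a))) =
      sw h (\<lambda>x y. gsw cr l (\<lambda>n a. tens H H (ra n x) (a * y)))"
begin

lemma ra_lin1': "lin X sc f \<Longrightarrow> lin X sc (\<lambda>x. ra (f x) k)"
  using ra_lin1 by (auto simp: lin_def)

lemma ra_lin2': "lin X sc f \<Longrightarrow> lin X sc (\<lambda>x. ra h (f x))"
  using ra_lin2 by (auto simp: lin_def)

lemmas [lin] = cmap_cr ra_lin1' ra_lin2'

lemma cr_coassoc':
  assumes s: "vector_space s"
    and F: "\<And>b c. lin H s (\<lambda>a. F a b c)" "\<And>a c. lin H s (\<lambda>b. F a b c)" "\<And>a b. lin H s (\<lambda>c. F a b c)"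
  shows "gsw cr l (\<lambda>n a. sw a (\<lambda>x y. F n x y)) = gsw cr l (\<lambda>n a. gsw cr n (\<lambda>x y. F x y a))"
proof -
  obtain \<phi> where \<phi>: "lin (tensor H (HH A)) s \<phi>" "\<And>a b c. \<phi> (T3 a b c) = F a b c"
    using gsw_transfer[of s F] s F by blast
  have "\<phi> (gsw cr l (\<lambda>n a. sw a (\<lambda>x y. T3 n x y))) = \<phi> (gsw cr l (\<lambda>n a. gsw cr n (\<lambda>x y. T3 x y a)))"
    by (simp only: cr_coassoc)
  then show ?thesis
    unfolding sw_gsw push3[OF \<phi> cmap_cr cmap_cr] push3[OF \<phi> cmap_cr cmap_comul] .
qed

lemma cr_counit': "lin H s f \<Longrightarrow> gsw cr k (\<lambda>a b. s (e b) (f a)) = f k"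
  using gsw_lin_H[OF cmap_cr, of s f k "\<lambda>a b. sc (e b) a"] cr_counit[of k] by (simp add: lin_H)

lemma cr_yd':
  assumes s: "vector_space s"
    and F: "\<And>b. lin H s (\<lambda>a. F a b)" "\<And>a. lin H s (\<lambda>b. F a b)"
  shows "sw h (\<lambda>x y. gsw cr (ra l y) (\<lambda>n a. F n (x * a))) = sw h (\<lambda>x y. gsw cr l (\<lambda>n a. F (ra n x) (a * y)))"
proof -
  obtain \<phi> where \<phi>: "lin (HH A) s \<phi>" "\<And>a b. \<phi> (tens H H a b) = F a b"
    using transfer2[of s F] s F by blast
  have "\<phi> (sw h (\<lambda>x y. gsw cr (ra l y) (\<lambda>n a. tens H H n (x * a)))) =
      \<phi> (sw h (\<lambda>x y. gsw cr l (\<lambda>n a. tens H H (ra n x) (a * y))))"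
    by (simp only: cr_yd)
  then show ?thesis
    unfolding sw_gsw push2[OF \<phi> cmap_comul cmap_cr] .
qed

end

locale yd_pair = left_yd A la cl + right_yd A ra cr
  for A :: "('k::field, 'h::ring_1) hopf" and la cl ra cr
begin

abbreviation "HM \<equiv> tensor H (HH A)"
abbreviation "MH \<equiv> tensor (HH A) H"

definition "LA h = on_HH A (\<lambda>k l. tens H H (la h k) l)"
definition "RA x h = on_HH A (\<lambda>k l. tens H H k (ra l h)) x"
definition "LC = on_HH A (\<lambda>k l. gsw cl k (\<lambda>a b. tens H (HH A) a (tens H H b l)))"
definition "RC = on_HH A (\<lambda>k l. gsw cr l (\<lambda>b a. tens (HH A) H (tens H H k b) a))"

abbreviation lsw where "lsw m F \<equiv> tlift H (HH A) F (LC m)"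
abbreviation rsw where "rsw m F \<equiv> tlift (HH A) H F (RC m)"

lemma LA_pure [simp]: "LA h (tens H H k l) = tens H H (la h k) l"
  unfolding LA_def by (rule tlift_tens[of tscale]) (intro lin)+

lemma RA_pure [simp]: "RA (tens H H k l) h = tens H H k (ra l h)"
  unfolding RA_def by (rule tlift_tens[of tscale]) (intro lin)+

lemma LC_pure: "LC (tens H H k l) = gsw cl k (\<lambda>a b. tens H (HH A) a (tens H H b l))"
  unfolding LC_def by (rule tlift_tens[of tscale]) (intro lin)+

lemma RC_pure: "RC (tens H H k l) = gsw cr l (\<lambda>b a. tens (HH A) H (tens H H k b) a)"
  unfolding RC_def by (rule tlift_tens[of tscale]) (intro lin)+

lemma LA_closed: "m \<in> carrier (HH A) \<Longrightarrow> LA h m \<in> carrier (HH A)"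
  and RA_closed: "m \<in> carrier (HH A) \<Longrightarrow> RA m h \<in> carrier (HH A)"
  and LC_closed: "m \<in> carrier (HH A) \<Longrightarrow> LC m \<in> carrier HM"
  and RC_closed: "m \<in> carrier (HH A) \<Longrightarrow> RC m \<in> carrier MH"
  unfolding LA_def RA_def LC_def RC_def by (intro lin; assumption)+

lemma LA_lin1: "m \<in> carrier (HH A) \<Longrightarrow> lin X sc f \<Longrightarrow> lin X tscale (\<lambda>x. LA (f x) m)"
  and RA_lin2: "m \<in> carrier (HH A) \<Longrightarrow> lin X sc f \<Longrightarrow> lin X tscale (\<lambda>x. RA m (f x))"
  unfolding LA_def RA_def by (intro lin; assumption)+

lemma LA_lin2: "(\<And>x. x \<in> carrier X \<Longrightarrow> f x \<in> carrier (HH A)) \<Longrightarrow> lin X tscale f \<Longrightarrow> lin X tscale (\<lambda>x. LA h (f x))"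
  and RA_lin1: "(\<And>x. x \<in> carrier X \<Longrightarrow> f x \<in> carrier (HH A)) \<Longrightarrow> lin X tscale f \<Longrightarrow> lin X tscale (\<lambda>x. RA (f x) h)"
  and LC_lin: "(\<And>x. x \<in> carrier X \<Longrightarrow> f x \<in> carrier (HH A)) \<Longrightarrow> lin X tscale f \<Longrightarrow> lin X tscale (\<lambda>x. LC (f x))"
  and RC_lin: "(\<And>x. x \<in> carrier X \<Longrightarrow> f x \<in> carrier (HH A)) \<Longrightarrow> lin X tscale f \<Longrightarrow> lin X tscale (\<lambda>x. RC (f x))"
  unfolding LA_def RA_def LC_def RC_def by (intro lin; assumption)+

lemmas [lin] = LA_closed RA_closed LC_closed RC_closed LA_lin1 LA_lin2 RA_lin1 RA_lin2 LC_lin RC_lin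

lemma lsw_pure:
  assumes "vector_space s" "bilin H (HH A) s F"
  shows "lsw (tens H H k l) F = gsw cl k (\<lambda>a b. F a (tens H H b l))"
  unfolding LC_pure
  by (subst gsw_lin[of _ HM s "tlift H (HH A) F"])
    (intro lin assms | simp add: tlift_tens[OF assms] tens_in_tensor)+

lemma rsw_pure:
  assumes "vector_space s" "bilin (HH A) H s F"
  shows "rsw (tens H H k l) F = gsw cr l (\<lambda>b a. F (tens H H k b) a)"
  unfolding RC_pure
  by (subst gsw_lin[of _ MH s "tlift (HH A) H F"])
    (intro lin assms | simp add: tlift_tens[OF assms] tens_in_tensor)+

lemmas lsw = lsw_pure[of tscale] and rsw = rsw_pure[of tscale]

lemmas eqI = lin_eq_on_tensor[OF space_H space_H, of tscale]

context fixes m assumes m: "m \<in> carrier (HH A)"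
begin

lemma actions:
  "LA 1 m = m" "LA (g * h) m = LA g (LA h m)" "RA m 1 = m" "RA m (g * h) = RA (RA m g) h"
  "RA (LA g m) h = LA g (RA m h)"
  by (rule eqI[OF _ _ _ m]; (intro lin; assumption)?; simp add: la_one la_mult ra_one ra_mult)+

lemma LC_coassoc:
  "lsw m (\<lambda>a n. sw a (\<lambda>x y. tens H HM x (tens H (HH A) y n))) =
   lsw m (\<lambda>a n. lsw n (\<lambda>b p. tens H HM a (tens H (HH A) b p)))"
proof (rule eqI[OF _ _ _ m], (intro lin; assumption)+)
  fix k l
  have "lsw (tens H H k l) (\<lambda>a n. sw a (\<lambda>x y. tens H HM x (tens H (HH A) y n))) =
      gsw cl k (\<lambda>a b. sw a (\<lambda>x y. tens H HM x (tens H (HH A) y (tens H H b l))))"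
    by (rule lsw) (intro lin; assumption)+
  also have "\<dots> = gsw cl k (\<lambda>a b. gsw cl b (\<lambda>x y. tens H HM a (tens H (HH A) x (tens H H y l))))"
    by (rule cl_coassoc'[of tscale]) (intro lin)+
  also have "\<dots> = gsw cl k (\<lambda>a b. lsw (tens H H b l) (\<lambda>b p. tens H HM a (tens H (HH A) b p)))"
    by (rule gsw_cong, rule lsw[symmetric]) (intro lin; assumption)+
  also have "\<dots> = lsw (tens H H k l) (\<lambda>a n. lsw n (\<lambda>b p. tens H HM a (tens H (HH A) b p)))"
    by (rule lsw[symmetric]) (intro lin; assumption)+
  finally show "lsw (tens H H k l) (\<lambda>a n. sw a (\<lambda>x y. tens H HM x (tens H (HH A) y n))) =
    lsw (tens H H k l) (\<lambda>a n. lsw n (\<lambda>b p. tens H HM a (tens H (HH A) b p)))" .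
qed

lemma RC_coassoc:
  "rsw m (\<lambda>n a. sw a (\<lambda>x y. tens MH H (tens (HH A) H n x) y)) =
   rsw m (\<lambda>n a. rsw n (\<lambda>p b. tens MH H (tens (HH A) H p b) a))"
proof (rule eqI[OF _ _ _ m], (intro lin; assumption)+)
  fix k l
  have "rsw (tens H H k l) (\<lambda>n a. sw a (\<lambda>x y. tens MH H (tens (HH A) H n x) y)) =
      gsw cr l (\<lambda>b a. sw a (\<lambda>x y. tens MH H (tens (HH A) H (tens H H k b) x) y))"
    by (rule rsw) (intro lin; assumption)+
  also have "\<dots> = gsw cr l (\<lambda>b a. gsw cr b (\<lambda>x y. tens MH H (tens (HH A) H (tens H H k x) y) a))"
    by (rule cr_coassoc'[of tscale]) (intro lin)+
  also have "\<dots> = gsw cr l (\<lambda>b a. rsw (tens H H k b) (\<lambda>p b. tens MH H (tens (HH A) H p b) a))"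
    by (rule gsw_cong, rule rsw[symmetric]) (intro lin; assumption)+
  also have "\<dots> = rsw (tens H H k l) (\<lambda>n a. rsw n (\<lambda>p b. tens MH H (tens (HH A) H p b) a))"
    by (rule rsw[symmetric]) (intro lin; assumption)+
  finally show "rsw (tens H H k l) (\<lambda>n a. sw a (\<lambda>x y. tens MH H (tens (HH A) H n x) y)) =
    rsw (tens H H k l) (\<lambda>n a. rsw n (\<lambda>p b. tens MH H (tens (HH A) H p b) a))" .
qed

lemma LC_counit: "lsw m (\<lambda>a n. tscale (e a) n) = m"
proof (rule eqI[OF _ _ _ m], (intro lin; assumption)+)
  fix k l
  have "lsw (tens H H k l) (\<lambda>a n. tscale (e a) n) = gsw cl k (\<lambda>a b. tscale (e a) (tens H H b l))"
    by (rule lsw) (intro lin; assumption)+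
  also have "\<dots> = tens H H k l"
    by (rule cl_counit') (intro lin)
  finally show "lsw (tens H H k l) (\<lambda>a n. tscale (e a) n) = tens H H k l" .
qed

lemma RC_counit: "rsw m (\<lambda>n a. tscale (e a) n) = m"
proof (rule eqI[OF _ _ _ m], (intro lin; assumption)+)
  fix k l
  have "rsw (tens H H k l) (\<lambda>n a. tscale (e a) n) = gsw cr l (\<lambda>b a. tscale (e a) (tens H H k b))"
    by (rule rsw) (intro lin; assumption)+
  also have "\<dots> = tens H H k l"
    by (rule cr_counit') (intro lin)
  finally show "rsw (tens H H k l) (\<lambda>n a. tscale (e a) n) = tens H H k l" .
qed

lemma LC_RC:
  "lsw m (\<lambda>a n. rsw n (\<lambda>p b. tens H MH a (tens (HH A) H p b))) =
   rsw m (\<lambda>n b. lsw n (\<lambda>a p. tens H MH a (tens (HH A) H p b)))"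
proof (rule eqI[OF _ _ _ m], (intro lin; assumption)+)
  fix k l
  have "lsw (tens H H k l) (\<lambda>a n. rsw n (\<lambda>p b. tens H MH a (tens (HH A) H p b))) =
      gsw cl k (\<lambda>a c. rsw (tens H H c l) (\<lambda>p b. tens H MH a (tens (HH A) H p b)))"
    by (rule lsw) (intro lin; assumption)+
  also have "\<dots> = gsw cl k (\<lambda>a c. gsw cr l (\<lambda>d b. tens H MH a (tens (HH A) H (tens H H c d) b)))"
    by (rule gsw_cong, rule rsw) (intro lin; assumption)+
  also have "\<dots> = gsw cr l (\<lambda>d b. gsw cl k (\<lambda>a c. tens H MH a (tens (HH A) H (tens H H c d) b)))"
    by (rule gsw_swap)
  also have "\<dots> = gsw cr l (\<lambda>d b. lsw (tens H H k d) (\<lambda>a p. tens H MH a (tens (HH A) H p b)))"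
    by (rule gsw_cong, rule lsw[symmetric]) (intro lin; assumption)+
  also have "\<dots> = rsw (tens H H k l) (\<lambda>n b. lsw n (\<lambda>a p. tens H MH a (tens (HH A) H p b)))"
    by (rule rsw[symmetric]) (intro lin; assumption)+
  finally show "lsw (tens H H k l) (\<lambda>a n. rsw n (\<lambda>p b. tens H MH a (tens (HH A) H p b))) =
    rsw (tens H H k l) (\<lambda>n b. lsw n (\<lambda>a p. tens H MH a (tens (HH A) H p b)))" .
qed

lemma LA_LC:
  "sw h (\<lambda>x y. lsw (LA x m) (\<lambda>a n. tens H (HH A) (a * y) n)) =
   sw h (\<lambda>x y. lsw m (\<lambda>a n. tens H (HH A) (x * a) (LA y n)))"
proof (rule eqI[OF _ _ _ m], (intro lin; assumption)+)
  fix k l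
  have "sw h (\<lambda>x y. lsw (LA x (tens H H k l)) (\<lambda>a n. tens H (HH A) (a * y) n)) =
      sw h (\<lambda>x y. gsw cl (la x k) (\<lambda>a b. tens H (HH A) (a * y) (tens H H b l)))"
    unfolding LA_pure by (rule sw_cong, rule lsw) (intro lin; assumption)+
  also have "\<dots> = sw h (\<lambda>x y. gsw cl k (\<lambda>a b. tens H (HH A) (x * a) (tens H H (la y b) l)))"
    by (rule cl_yd'[of tscale]) (intro lin)+
  also have "\<dots> = sw h (\<lambda>x y. lsw (tens H H k l) (\<lambda>a n. tens H (HH A) (x * a) (LA y n)))"
    unfolding LA_pure[symmetric] by (rule sw_cong, rule lsw[symmetric]) (intro lin; assumption)+
  finally show "sw h (\<lambda>x y. lsw (LA x (tens H H k l)) (\<lambda>a n. tens H (HH A) (a * y) n)) =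
    sw h (\<lambda>x y. lsw (tens H H k l) (\<lambda>a n. tens H (HH A) (x * a) (LA y n)))" .
qed

lemma RA_RC:
  "sw h (\<lambda>x y. rsw (RA m y) (\<lambda>n a. tens (HH A) H n (x * a))) =
   sw h (\<lambda>x y. rsw m (\<lambda>n a. tens (HH A) H (RA n x) (a * y)))"
proof (rule eqI[OF _ _ _ m], (intro lin; assumption)+)
  fix k l
  have "sw h (\<lambda>x y. rsw (RA (tens H H k l) y) (\<lambda>n a. tens (HH A) H n (x * a))) =
      sw h (\<lambda>x y. gsw cr (ra l y) (\<lambda>b a. tens (HH A) H (tens H H k b) (x * a)))"
    unfolding RA_pure by (rule sw_cong, rule rsw) (intro lin; assumption)+
  also have "\<dots> = sw h (\<lambda>x y. gsw cr l (\<lambda>b a. tens (HH A) H (tens H H k (ra b x)) (a * y)))"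
    by (rule cr_yd'[of tscale]) (intro lin)+
  also have "\<dots> = sw h (\<lambda>x y. rsw (tens H H k l) (\<lambda>n a. tens (HH A) H (RA n x) (a * y)))"
    unfolding RA_pure[symmetric] by (rule sw_cong, rule rsw[symmetric]) (intro lin; assumption)+
  finally show "sw h (\<lambda>x y. rsw (RA (tens H H k l) y) (\<lambda>n a. tens (HH A) H n (x * a))) =
    sw h (\<lambda>x y. rsw (tens H H k l) (\<lambda>n a. tens (HH A) H (RA n x) (a * y)))" .
qed

lemma LA_RC: "RC (LA h m) = rsw m (\<lambda>n a. tens (HH A) H (LA h n) a)"
proof (rule eqI[OF _ _ _ m], (intro lin; assumption)+)
  fix k l
  have "rsw (tens H H k l) (\<lambda>n a. tens (HH A) H (LA h n) a) =
      gsw cr l (\<lambda>b a. tens (HH A) H (LA h (tens H H k b)) a)"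
    by (rule rsw) (intro lin; assumption)+
  then show "RC (LA h (tens H H k l)) = rsw (tens H H k l) (\<lambda>n a. tens (HH A) H (LA h n) a)"
    by (simp add: RC_pure)
qed

lemma RA_LC: "LC (RA m h) = lsw m (\<lambda>a n. tens H (HH A) a (RA n h))"
proof (rule eqI[OF _ _ _ m], (intro lin; assumption)+)
  fix k l
  have "lsw (tens H H k l) (\<lambda>a n. tens H (HH A) a (RA n h)) =
      gsw cl k (\<lambda>a b. tens H (HH A) a (RA (tens H H b l) h))"
    by (rule lsw) (intro lin; assumption)+
  then show "LC (RA (tens H H k l) h) = lsw (tens H H k l) (\<lambda>a n. tens H (HH A) a (RA n h))"
    by (simp add: LC_pure)
qed

end

definition pair_data :: "('k, 'h, ('k, 'h, 'h) tensor) ydl_data" where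
  "pair_data = \<lparr>carrier = carrier (HH A), scale = tscale, lact = LA, ract = RA, lcoact = LC, rcoact = RC\<rparr>"

lemma pair_simps [simp]:
  "carrier pair_data = carrier (HH A)" "scale pair_data = tscale" "lact pair_data = LA"
  "ract pair_data = RA" "lcoact pair_data = LC" "rcoact pair_data = RC"
  by (simp_all add: pair_data_def)

lemma pair_cong [simp]:
  "tens H pair_data = tens H (HH A)" "tens pair_data H = tens (HH A) H"
  "tensor H pair_data = HM" "tensor pair_data H = MH"
  "tlift H pair_data F = tlift H (HH A) F" "tlift pair_data H F' = tlift (HH A) H F'"
  by (intro space_cong; simp)+

lemma lin_pair [simp]: "lin pair_data s f = lin (HH A) s f"
  by (simp add: lin_def)

lemma bilin_pair [simp]:
  "bilin H pair_data s F = bilin H (HH A) s F" "bilin pair_data H s F' = bilin (HH A) H s F'"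
  by (simp_all add: bilin_def)

lemma ydl_pair: "ydl_bimodule A pair_data"
proof (unfold_locales, unfold lsweedler_def rsweedler_def pair_simps pair_cong lin_pair bilin_pair)
  have "is_space (HH A)" by (intro lin)
  then show "is_space pair_data" by (simp add: is_space_def)
qed (rule LC_coassoc RC_coassoc LC_counit RC_counit LC_RC LA_LC RA_RC LA_RC RA_LC
  actions LA_closed RA_closed LC_closed RC_closed; assumption | intro lin; assumption)+

end

context hopf_algebra
begin

definition "reg_lcoact k = sw k (\<lambda>a b. sw b (\<lambda>c d. tens H H (a * S d) c))"
definition "reg_rcoact l = sw l (\<lambda>a b. sw b (\<lambda>c d. tens H H c (S a * d)))"

lemma cmap_reg [lin]: "cmap reg_lcoact" "cmap reg_rcoact"
  unfolding cmap_def reg_lcoact_def reg_rcoact_def by (safe; intro lin)+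

lemma gsw_reg_lcoact:
  assumes s: "vector_space s"
    and F: "\<And>b. lin H s (\<lambda>a. F a b)" "\<And>a. lin H s (\<lambda>b. F a b)"
  shows "gsw reg_lcoact k F = sw k (\<lambda>a b. sw b (\<lambda>c d. F (a * S d) c))"
proof -
  obtain \<phi> where \<phi>: "lin (HH A) s \<phi>" "\<And>a b. \<phi> (tens H H a b) = F a b"
    using transfer2[of s F] s F by blast
  have "\<phi> (reg_lcoact k) = gsw reg_lcoact k F"
    unfolding gsw_def \<phi>(2)[symmetric]
    by (rule lin_on_tensor[OF space_H space_H \<phi>(1)]) (use cmap_reg in \<open>simp add: cmap_def\<close>)
  then show ?thesis
    unfolding reg_lcoact_def sw_gsw push2[OF \<phi> cmap_comul cmap_comul] by simp
qed

lemma gsw_reg_rcoact: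
  assumes s: "vector_space s"
    and F: "\<And>b. lin H s (\<lambda>a. F a b)" "\<And>a. lin H s (\<lambda>b. F a b)"
  shows "gsw reg_rcoact k F = sw k (\<lambda>a b. sw b (\<lambda>c d. F c (S a * d)))"
proof -
  obtain \<phi> where \<phi>: "lin (HH A) s \<phi>" "\<And>a b. \<phi> (tens H H a b) = F a b"
    using transfer2[of s F] s F by blast
  have "\<phi> (reg_rcoact k) = gsw reg_rcoact k F"
    unfolding gsw_def \<phi>(2)[symmetric]
    by (rule lin_on_tensor[OF space_H space_H \<phi>(1)]) (use cmap_reg in \<open>simp add: cmap_def\<close>)
  then show ?thesis
    unfolding reg_rcoact_def sw_gsw push2[OF \<phi> cmap_comul cmap_comul] by simp
qed

lemma sw_mult_S:
  assumes s: "vector_space s"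
    and F: "\<And>b. lin H s (\<lambda>a. F a b)" "\<And>a. lin H s (\<lambda>b. F a b)"
  shows "sw (g * S h) F = sw g (\<lambda>x y. sw h (\<lambda>u v. F (x * S v) (y * S u)))"
proof -
  note F' = F(1)[THEN lin_comp] F(2)[THEN lin_comp]
  have "sw (g * S h) F = sw g (\<lambda>x y. sw (S h) (\<lambda>u v. F (x * u) (y * v)))"
    by (rule sw_mult[OF s F])
  also have "\<dots> = sw g (\<lambda>x y. sw h (\<lambda>u v. F (x * S v) (y * S u)))"
    by (rule sw_cong, rule sw_S[OF s]) (rule F'; intro lin)+
  finally show ?thesis .
qed

lemma sw_S_mult:
  assumes s: "vector_space s"
    and F: "\<And>b. lin H s (\<lambda>a. F a b)" "\<And>a. lin H s (\<lambda>b. F a b)"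
  shows "sw (S g * h) F = sw g (\<lambda>x y. sw h (\<lambda>u v. F (S y * u) (S x * v)))"
proof -
  note F' = F(1)[THEN lin_comp] F(2)[THEN lin_comp]
  have "sw (S g * h) F = sw (S g) (\<lambda>x y. sw h (\<lambda>u v. F (x * u) (y * v)))"
    by (rule sw_mult[OF s F])
  also have "\<dots> = sw g (\<lambda>x y. sw h (\<lambda>u v. F (S y * u) (S x * v)))"
    by (rule sw_S[OF s]) (intro lin s F')+
  finally show ?thesis .
qed

lemma left_reg: "left_yd A (*) reg_lcoact"
proof
  fix k g h :: 'h
  show "gsw reg_lcoact k (\<lambda>a b. sw a (\<lambda>x y. T3 x y b)) = gsw reg_lcoact k (\<lambda>a b. gsw reg_lcoact b (\<lambda>x y. T3 a x y))"
  proof -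
    let ?R = "sw k (\<lambda>x t. sw t (\<lambda>y b. sw b (\<lambda>c d. sw d (\<lambda>u v. T3 (x * S v) (y * S u) c))))"
    have "gsw reg_lcoact k (\<lambda>a b. sw a (\<lambda>x y. T3 x y b)) =
        sw k (\<lambda>a b. sw b (\<lambda>c d. sw (a * S d) (\<lambda>x y. T3 x y c)))"
      by (rule gsw_reg_lcoact[of tscale]) (intro lin)+
    also have "\<dots> = sw k (\<lambda>a b. sw b (\<lambda>c d. sw a (\<lambda>x y. sw d (\<lambda>u v. T3 (x * S v) (y * S u) c))))"
      by (rule sw_cong, rule sw_cong, rule sw_mult_S[of tscale]) (intro lin)+
    also have "\<dots> = sw k (\<lambda>a b. sw a (\<lambda>x y. sw b (\<lambda>c d. sw d (\<lambda>u v. T3 (x * S v) (y * S u) c))))"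
      by (rule sw_cong, rule sw_swap)
    also have "\<dots> = ?R"
      by (rule sw_coassoc[of tscale]) (intro lin)+
    finally have 1: "gsw reg_lcoact k (\<lambda>a b. sw a (\<lambda>x y. T3 x y b)) = ?R" .
    have "gsw reg_lcoact k (\<lambda>a b. gsw reg_lcoact b (\<lambda>x y. T3 a x y)) =
        sw k (\<lambda>a b. sw b (\<lambda>c d. gsw reg_lcoact c (\<lambda>x y. T3 (a * S d) x y)))"
      by (rule gsw_reg_lcoact[of tscale]) (intro lin)+
    also have "\<dots> = sw k (\<lambda>a b. sw b (\<lambda>c d. sw c (\<lambda>x y. sw y (\<lambda>z w. T3 (a * S d) (x * S w) z))))"
      by (rule sw_cong, rule sw_cong, rule gsw_reg_lcoact[of tscale]) (intro lin)+
    also have "\<dots> = sw k (\<lambda>a b. sw b (\<lambda>x t. sw t (\<lambda>y d. sw y (\<lambda>z w. T3 (a * S d) (x * S w) z))))"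
      by (rule sw_cong, rule sw_coassoc[of tscale]) (intro lin)+
    also have "\<dots> = ?R"
      by (rule sw_cong, rule sw_cong, rule sw_coassoc[of tscale]) (intro lin)+
    finally show ?thesis using 1 by simp
  qed
  show "gsw reg_lcoact k (\<lambda>a b. sc (e a) b) = k"
  proof -
    have "gsw reg_lcoact k (\<lambda>a b. sc (e a) b) = sw k (\<lambda>a b. sw b (\<lambda>c d. sc (e (a * S d)) c))"
      by (rule gsw_reg_lcoact[of sc]) (intro lin)+
    also have "\<dots> = sw k (\<lambda>a b. sw b (\<lambda>c d. sc (e d) (sc (e a) c)))"
      by (simp add: counit_mult e_S mult.commute)
    also have "\<dots> = sw k (\<lambda>a b. sc (e a) b)"
      by (rule sw_cong, rule sw_counit_right) (intro lin)
    finally show ?thesis by (simp add: counit_left)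
  qed
  show "sw h (\<lambda>x y. gsw reg_lcoact (x * k) (\<lambda>a b. tens H H (a * y) b)) =
      sw h (\<lambda>x y. gsw reg_lcoact k (\<lambda>a b. tens H H (x * a) (y * b)))"
  proof -
    let ?K = "\<lambda>x p q g u r t. tens H H (x * u * (S t * (S q * g))) (p * r)"
    have "sw h (\<lambda>m g. gsw reg_lcoact (m * k) (\<lambda>a b. tens H H (a * g) b)) =
        sw h (\<lambda>m g. sw (m * k) (\<lambda>a b. sw b (\<lambda>c d. tens H H (a * S d * g) c)))"
      by (rule sw_cong, rule gsw_reg_lcoact[of tscale]) (intro lin)+
    also have "\<dots> = sw h (\<lambda>m g. sw m (\<lambda>x y. sw k (\<lambda>u v. sw (y * v) (\<lambda>c d. tens H H (x * u * S d * g) c))))"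
      by (rule sw_cong, rule sw_mult[of tscale]) (intro lin)+
    also have "\<dots> = sw h (\<lambda>m g. sw m (\<lambda>x y. sw k (\<lambda>u v. sw y (\<lambda>p q. sw v (\<lambda>r t.
        tens H H (x * u * S (q * t) * g) (p * r))))))"
      by (rule sw_cong, rule sw_cong, rule sw_cong, rule sw_mult[of tscale]) (intro lin)+
    also have "\<dots> = sw h (\<lambda>m g. sw m (\<lambda>x y. sw k (\<lambda>u v. sw y (\<lambda>p q. sw v (\<lambda>r t. ?K x p q g u r t)))))"
      by (simp add: S_mult mult.assoc)
    also have "\<dots> = sw h (\<lambda>m g. sw m (\<lambda>x y. sw y (\<lambda>p q. sw k (\<lambda>u v. sw v (\<lambda>r t. ?K x p q g u r t)))))"
      by (rule sw_cong, rule sw_cong, rule sw_swap)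
    also have "\<dots> = sw h (\<lambda>x m. sw m (\<lambda>y g. sw y (\<lambda>p q. sw k (\<lambda>u v. sw v (\<lambda>r t. ?K x p q g u r t)))))"
      by (rule sw_coassoc[of tscale]) (intro lin)+
    also have "\<dots> = sw h (\<lambda>x m. sw m (\<lambda>p y. sw y (\<lambda>q g. sw k (\<lambda>u v. sw v (\<lambda>r t. ?K x p q g u r t)))))"
      by (rule sw_cong, rule sw_coassoc[of tscale]) (intro lin)+
    also have "\<dots> = sw h (\<lambda>x m. sw m (\<lambda>p y. tscale (e y) (sw k (\<lambda>u v. sw v (\<lambda>r t.
        tens H H (x * u * (S t * 1)) (p * r))))))"
      by (rule sw_cong, rule sw_cong, rule sw_S_left) (intro lin)
    also have "\<dots> = sw h (\<lambda>x m. sw k (\<lambda>u v. sw v (\<lambda>r t. tens H H (x * u * (S t * 1)) (m * r))))"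
      by (rule sw_cong, rule sw_counit_right) (intro lin)
    also have "\<dots> = sw h (\<lambda>x m. sw k (\<lambda>u v. sw v (\<lambda>r t. tens H H (x * (u * S t)) (m * r))))"
      by (simp add: mult.assoc)
    also have "\<dots> = sw h (\<lambda>x y. gsw reg_lcoact k (\<lambda>a b. tens H H (x * a) (y * b)))"
      by (rule sw_cong, rule gsw_reg_lcoact[of tscale, symmetric]) (intro lin)+
    finally show ?thesis .
  qed
qed (simp_all add: mult.assoc | intro lin)+

lemma right_reg: "right_yd A (*) reg_rcoact"
proof
  fix l g h :: 'h
  show "gsw reg_rcoact l (\<lambda>n a. sw a (\<lambda>x y. T3 n x y)) = gsw reg_rcoact l (\<lambda>n a. gsw reg_rcoact n (\<lambda>x y. T3 x y a))"
  proof -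
    let ?R = "sw l (\<lambda>a b. sw a (\<lambda>x y. sw b (\<lambda>c d. sw d (\<lambda>u v. T3 c (S y * u) (S x * v)))))"
    have "gsw reg_rcoact l (\<lambda>n a. sw a (\<lambda>x y. T3 n x y)) =
        sw l (\<lambda>a b. sw b (\<lambda>c d. sw (S a * d) (\<lambda>x y. T3 c x y)))"
      by (rule gsw_reg_rcoact[of tscale]) (intro lin)+
    also have "\<dots> = sw l (\<lambda>a b. sw b (\<lambda>c d. sw a (\<lambda>x y. sw d (\<lambda>u v. T3 c (S y * u) (S x * v)))))"
      by (rule sw_cong, rule sw_cong, rule sw_S_mult[of tscale]) (intro lin)+
    also have "\<dots> = ?R"
      by (rule sw_cong, rule sw_swap)
    also have "\<dots> = sw l (\<lambda>x t. sw t (\<lambda>y b. sw b (\<lambda>c d. sw d (\<lambda>u v. T3 c (S y * u) (S x * v)))))"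
      by (rule sw_coassoc[of tscale]) (intro lin)+
    finally have 1: "gsw reg_rcoact l (\<lambda>n a. sw a (\<lambda>x y. T3 n x y)) = \<dots>" .
    have "gsw reg_rcoact l (\<lambda>n a. gsw reg_rcoact n (\<lambda>x y. T3 x y a)) =
        sw l (\<lambda>a b. sw b (\<lambda>c d. gsw reg_rcoact c (\<lambda>x y. T3 x y (S a * d))))"
      by (rule gsw_reg_rcoact[of tscale]) (intro lin)+
    also have "\<dots> = sw l (\<lambda>a b. sw b (\<lambda>c d. sw c (\<lambda>x y. sw y (\<lambda>z w. T3 z (S x * w) (S a * d)))))"
      by (rule sw_cong, rule sw_cong, rule gsw_reg_rcoact[of tscale]) (intro lin)+
    also have "\<dots> = sw l (\<lambda>a b. sw b (\<lambda>x t. sw t (\<lambda>y d. sw y (\<lambda>z w. T3 z (S x * w) (S a * d)))))"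
      by (rule sw_cong, rule sw_coassoc[of tscale]) (intro lin)+
    also have "\<dots> = sw l (\<lambda>a b. sw b (\<lambda>x t. sw t (\<lambda>z y. sw y (\<lambda>w d. T3 z (S x * w) (S a * d)))))"
      by (rule sw_cong, rule sw_cong, rule sw_coassoc[of tscale]) (intro lin)+
    finally show ?thesis using 1 by simp
  qed
  show "gsw reg_rcoact l (\<lambda>n a. sc (e a) n) = l"
  proof -
    have "gsw reg_rcoact l (\<lambda>n a. sc (e a) n) = sw l (\<lambda>a b. sw b (\<lambda>c d. sc (e (S a * d)) c))"
      by (rule gsw_reg_rcoact[of sc]) (intro lin)+
    also have "\<dots> = sw l (\<lambda>a b. sw b (\<lambda>c d. sc (e d) (sc (e a) c)))"
      by (simp add: counit_mult e_S mult.commute)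
    also have "\<dots> = sw l (\<lambda>a b. sc (e a) b)"
      by (rule sw_cong, rule sw_counit_right) (intro lin)
    finally show ?thesis by (simp add: counit_left)
  qed
  show "sw h (\<lambda>x y. gsw reg_rcoact (l * y) (\<lambda>n a. tens H H n (x * a))) =
      sw h (\<lambda>x y. gsw reg_rcoact l (\<lambda>n a. tens H H (n * x) (a * y)))"
  proof -
    let ?K = "\<lambda>g x p q u r t. tens H H (r * p) (g * S x * (S u * (t * q)))"
    have "sw h (\<lambda>g m. gsw reg_rcoact (l * m) (\<lambda>n a. tens H H n (g * a))) =
        sw h (\<lambda>g m. sw (l * m) (\<lambda>a b. sw b (\<lambda>c d. tens H H c (g * (S a * d)))))"
      by (rule sw_cong, rule gsw_reg_rcoact[of tscale]) (intro lin)+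
    also have "\<dots> = sw h (\<lambda>g m. sw l (\<lambda>u v. sw m (\<lambda>x y. sw (v * y) (\<lambda>c d. tens H H c (g * (S (u * x) * d))))))"
      by (rule sw_cong, rule sw_mult[of tscale]) (intro lin)+
    also have "\<dots> = sw h (\<lambda>g m. sw l (\<lambda>u v. sw m (\<lambda>x y. sw v (\<lambda>r t. sw y (\<lambda>p q.
        tens H H (r * p) (g * (S (u * x) * (t * q))))))))"
      by (rule sw_cong, rule sw_cong, rule sw_cong, rule sw_mult[of tscale]) (intro lin)+
    also have "\<dots> = sw h (\<lambda>g m. sw l (\<lambda>u v. sw m (\<lambda>x y. sw v (\<lambda>r t. sw y (\<lambda>p q. ?K g x p q u r t)))))"
      by (simp add: S_mult mult.assoc)
    also have "\<dots> = sw h (\<lambda>g m. sw m (\<lambda>x y. sw l (\<lambda>u v. sw v (\<lambda>r t. sw y (\<lambda>p q. ?K g x p q u r t)))))"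
      by (rule sw_cong, rule sw_swap)
    also have "\<dots> = sw h (\<lambda>m y. sw m (\<lambda>g x. sw l (\<lambda>u v. sw v (\<lambda>r t. sw y (\<lambda>p q. ?K g x p q u r t)))))"
      by (rule sw_coassoc[of tscale, symmetric]) (intro lin)+
    also have "\<dots> = sw h (\<lambda>m y. tscale (e m) (sw l (\<lambda>u v. sw v (\<lambda>r t. sw y (\<lambda>p q.
        tens H H (r * p) (1 * (S u * (t * q))))))))"
      by (rule sw_cong, rule sw_S_right) (intro lin)
    also have "\<dots> = sw l (\<lambda>u v. sw v (\<lambda>r t. sw h (\<lambda>p q. tens H H (r * p) (1 * (S u * (t * q))))))"
      by (rule sw_counit_left) (intro lin)
    also have "\<dots> = sw l (\<lambda>u v. sw h (\<lambda>p q. sw v (\<lambda>r t. tens H H (r * p) (S u * t * q))))"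
      by (rule sw_cong, subst sw_swap) (simp add: mult.assoc)
    also have "\<dots> = sw h (\<lambda>p q. sw l (\<lambda>u v. sw v (\<lambda>r t. tens H H (r * p) (S u * t * q))))"
      by (rule sw_swap)
    also have "\<dots> = sw h (\<lambda>x y. gsw reg_rcoact l (\<lambda>n a. tens H H (n * x) (a * y)))"
      by (rule sw_cong, rule gsw_reg_rcoact[of tscale, symmetric]) (intro lin)+
    finally show ?thesis .
  qed
qed (simp_all add: mult.assoc | intro lin)+

lemma left_adj: "left_yd A (\<lambda>h k. sw h (\<lambda>a b. a * k * S b)) (comul A)"
proof (unfold_locales, unfold sw_gsw[symmetric])
  fix k g h :: 'h
  show "sw k (\<lambda>a b. sw a (\<lambda>x y. T3 x y b)) = sw k (\<lambda>a b. sw b (\<lambda>x y. T3 a x y))"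
    by (rule comul_coassoc)
  show "sw k (\<lambda>a b. sc (e a) b) = k"
    by (rule counit_left)
  show "sw 1 (\<lambda>a b. a * k * S b) = k"
    by (subst sw_one[of sc], (intro lin)+) (simp add: S_one)
  show "sw (g * h) (\<lambda>a b. a * k * S b) = sw g (\<lambda>a b. a * sw h (\<lambda>a b. a * k * S b) * S b)"
  proof -
    have "sw (g * h) (\<lambda>a b. a * k * S b) = sw g (\<lambda>a b. sw h (\<lambda>c d. a * c * k * S (b * d)))"
      by (rule sw_mult[of sc]) (intro lin)+
    also have "\<dots> = sw g (\<lambda>a b. sw h (\<lambda>c d. a * (c * k * S d) * S b))"
      by (simp add: S_mult mult.assoc)
    also have "\<dots> = sw g (\<lambda>a b. a * sw h (\<lambda>a b. a * k * S b) * S b)"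
      by (rule sw_cong, rule sw_lin_H[of sc "\<lambda>z. a * z * S b" for a b, symmetric]) (intro lin)
    finally show ?thesis .
  qed
  show "sw h (\<lambda>x y. sw (sw x (\<lambda>a b. a * k * S b)) (\<lambda>a b. tens H H (a * y) b)) =
      sw h (\<lambda>x y. sw k (\<lambda>a b. tens H H (x * a) (sw y (\<lambda>c d. c * b * S d))))"
  proof -
    let ?K = "\<lambda>r s p q g u v. tens H H (r * u * (S q * g)) (s * v * S p)"
    have "sw h (\<lambda>m g. sw (sw m (\<lambda>x y. x * k * S y)) (\<lambda>a b. tens H H (a * g) b)) =
        sw h (\<lambda>m g. sw m (\<lambda>x y. sw (x * k * S y) (\<lambda>a b. tens H H (a * g) b)))"
      by (rule sw_cong, rule sw_lin_H[of tscale "\<lambda>z. sw z (\<lambda>a b. tens H H (a * g) b)" for g]) (intro lin)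
    also have "\<dots> = sw h (\<lambda>m g. sw m (\<lambda>x y. sw (x * k) (\<lambda>a b. sw y (\<lambda>p q. tens H H (a * S q * g) (b * S p)))))"
      by (rule sw_cong, rule sw_cong, rule sw_mult_S[of tscale]) (intro lin)+
    also have "\<dots> = sw h (\<lambda>m g. sw m (\<lambda>x y. sw x (\<lambda>r s. sw k (\<lambda>u v. sw y (\<lambda>p q.
        tens H H (r * u * S q * g) (s * v * S p))))))"
      by (rule sw_cong, rule sw_cong, rule sw_mult[of tscale]) (intro lin)+
    also have "\<dots> = sw h (\<lambda>m g. sw m (\<lambda>x y. sw x (\<lambda>r s. sw y (\<lambda>p q. sw k (\<lambda>u v. ?K r s p q g u v)))))"
      by (rule sw_cong, rule sw_cong, rule sw_cong, subst sw_swap) (simp add: mult.assoc)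
    also have "\<dots> = sw h (\<lambda>m g. sw m (\<lambda>r n. sw n (\<lambda>s y. sw y (\<lambda>p q. sw k (\<lambda>u v. ?K r s p q g u v)))))"
      by (rule sw_cong, rule sw_coassoc[of tscale]) (intro lin)+
    also have "\<dots> = sw h (\<lambda>r t. sw t (\<lambda>n g. sw n (\<lambda>s y. sw y (\<lambda>p q. sw k (\<lambda>u v. ?K r s p q g u v)))))"
      by (rule sw_coassoc[of tscale]) (intro lin)+
    also have "\<dots> = sw h (\<lambda>r t. sw t (\<lambda>s w. sw w (\<lambda>y g. sw y (\<lambda>p q. sw k (\<lambda>u v. ?K r s p q g u v)))))"
      by (rule sw_cong, rule sw_coassoc[of tscale]) (intro lin)+
    also have "\<dots> = sw h (\<lambda>r t. sw t (\<lambda>s w. sw w (\<lambda>p z. sw z (\<lambda>q g. sw k (\<lambda>u v. ?K r s p q g u v)))))"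
      by (rule sw_cong, rule sw_cong, rule sw_coassoc[of tscale]) (intro lin)+
    also have "\<dots> = sw h (\<lambda>r t. sw t (\<lambda>s w. sw w (\<lambda>p z. tscale (e z) (sw k (\<lambda>u v.
        tens H H (r * u * 1) (s * v * S p))))))"
      by (rule sw_cong, rule sw_cong, rule sw_cong, rule sw_S_left) (intro lin)
    also have "\<dots> = sw h (\<lambda>r t. sw t (\<lambda>s w. sw k (\<lambda>u v. tens H H (r * u * 1) (s * v * S w))))"
      by (rule sw_cong, rule sw_cong, rule sw_counit_right) (intro lin)
    also have "\<dots> = sw h (\<lambda>x y. sw k (\<lambda>a b. sw y (\<lambda>c d. tens H H (x * a) (c * b * S d))))"
      by (rule sw_cong, subst sw_swap) simp
    also have "\<dots> = sw h (\<lambda>x y. sw k (\<lambda>a b. tens H H (x * a) (sw y (\<lambda>c d. c * b * S d))))"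
      by (rule sw_cong, rule sw_cong, rule sw_lin_H[where s = tscale, symmetric]) (intro lin)
    finally show ?thesis .
  qed
qed (intro lin)+

lemma right_adj: "right_yd A (\<lambda>l h. sw h (\<lambda>a b. S a * l * b)) (comul A)"
proof (unfold_locales, unfold sw_gsw[symmetric])
  fix l g h :: 'h
  show "sw l (\<lambda>n a. sw a (\<lambda>x y. T3 n x y)) = sw l (\<lambda>n a. sw n (\<lambda>x y. T3 x y a))"
    by (rule comul_coassoc[symmetric])
  show "sw l (\<lambda>n a. sc (e a) n) = l"
    by (rule counit_right)
  show "sw 1 (\<lambda>a b. S a * l * b) = l"
    by (subst sw_one[of sc], (intro lin)+) (simp add: S_one)
  show "sw (g * h) (\<lambda>a b. S a * l * b) = sw h (\<lambda>a b. S a * sw g (\<lambda>a b. S a * l * b) * b)"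
  proof -
    have "sw (g * h) (\<lambda>a b. S a * l * b) = sw g (\<lambda>a b. sw h (\<lambda>c d. S (a * c) * l * (b * d)))"
      by (rule sw_mult[of sc]) (intro lin)+
    also have "\<dots> = sw h (\<lambda>c d. sw g (\<lambda>a b. S c * (S a * l * b) * d))"
      by (subst sw_swap) (simp add: S_mult mult.assoc)
    also have "\<dots> = sw h (\<lambda>a b. S a * sw g (\<lambda>a b. S a * l * b) * b)"
      by (rule sw_cong, rule sw_lin_H[of sc "\<lambda>z. S c * z * d" for c d, symmetric]) (intro lin)
    finally show ?thesis .
  qed
  show "sw h (\<lambda>x y. sw (sw y (\<lambda>a b. S a * l * b)) (\<lambda>n a. tens H H n (x * a))) =
      sw h (\<lambda>x y. sw l (\<lambda>n a. tens H H (sw x (\<lambda>c d. S c * n * d)) (a * y)))"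
  proof -
    let ?K = "\<lambda>g r s p q u v. tens H H (S s * u * p) (g * S r * (v * q))"
    have "sw h (\<lambda>g m. sw (sw m (\<lambda>x y. S x * l * y)) (\<lambda>n a. tens H H n (g * a))) =
        sw h (\<lambda>g m. sw m (\<lambda>x y. sw (S x * l * y) (\<lambda>n a. tens H H n (g * a))))"
      by (rule sw_cong, rule sw_lin_H[of tscale "\<lambda>z. sw z (\<lambda>n a. tens H H n (g * a))" for g]) (intro lin)
    also have "\<dots> = sw h (\<lambda>g m. sw m (\<lambda>x y. sw (S x * l) (\<lambda>a b. sw y (\<lambda>p q. tens H H (a * p) (g * (b * q))))))"
      by (rule sw_cong, rule sw_cong, rule sw_mult[of tscale]) (intro lin)+
    also have "\<dots> = sw h (\<lambda>g m. sw m (\<lambda>x y. sw x (\<lambda>r s. sw l (\<lambda>u v. sw y (\<lambda>p q.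
        tens H H (S s * u * p) (g * (S r * v * q)))))))"
      by (rule sw_cong, rule sw_cong, rule sw_S_mult[of tscale]) (intro lin)+
    also have "\<dots> = sw h (\<lambda>g m. sw m (\<lambda>x y. sw x (\<lambda>r s. sw y (\<lambda>p q. sw l (\<lambda>u v. ?K g r s p q u v)))))"
      by (rule sw_cong, rule sw_cong, rule sw_cong, subst sw_swap) (simp add: mult.assoc)
    also have "\<dots> = sw h (\<lambda>g m. sw m (\<lambda>r n. sw n (\<lambda>s y. sw y (\<lambda>p q. sw l (\<lambda>u v. ?K g r s p q u v)))))"
      by (rule sw_cong, rule sw_coassoc[of tscale]) (intro lin)+
    also have "\<dots> = sw h (\<lambda>w n. sw w (\<lambda>g r. sw n (\<lambda>s y. sw y (\<lambda>p q. sw l (\<lambda>u v. ?K g r s p q u v)))))"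
      by (rule sw_coassoc[of tscale, symmetric]) (intro lin)+
    also have "\<dots> = sw h (\<lambda>w n. tscale (e w) (sw n (\<lambda>s y. sw y (\<lambda>p q. sw l (\<lambda>u v.
        tens H H (S s * u * p) (1 * (v * q)))))))"
      by (rule sw_cong, rule sw_S_right) (intro lin)
    also have "\<dots> = sw h (\<lambda>s y. sw y (\<lambda>p q. sw l (\<lambda>u v. tens H H (S s * u * p) (1 * (v * q)))))"
      by (rule sw_counit_left) (intro lin)
    also have "\<dots> = sw h (\<lambda>x y. sw x (\<lambda>c d. sw l (\<lambda>n a. tens H H (S c * n * d) (1 * (a * y)))))"
      by (rule sw_coassoc[of tscale, symmetric]) (intro lin)+
    also have "\<dots> = sw h (\<lambda>x y. sw l (\<lambda>n a. sw x (\<lambda>c d. tens H H (S c * n * d) (a * y))))"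
      by (rule sw_cong, subst sw_swap) simp
    also have "\<dots> = sw h (\<lambda>x y. sw l (\<lambda>n a. tens H H (sw x (\<lambda>c d. S c * n * d)) (a * y)))"
      by (rule sw_cong, rule sw_cong, rule sw_lin_H[of tscale "\<lambda>z. tens H H z w" for w, symmetric]) (intro lin)
    finally show ?thesis .
  qed
qed (intro lin)+

lemma pure_sw:
  "tens H H (sw h F) l = sw h (\<lambda>a b. tens H H (F a b) l)"
  "tens H H k (sw h F) = sw h (\<lambda>a b. tens H H k (F a b))"
  by (rule sw_lin_H[of tscale "\<lambda>z. tens H H z l"], intro lin)
    (rule sw_lin_H[of tscale "\<lambda>z. tens H H k z"], intro lin)

lemma reg_coacts:
  "gsw reg_lcoact k (\<lambda>a b. tens H (HH A) a (tens H H b l)) =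
    sw k (\<lambda>a b. sw b (\<lambda>c d. tens H (HH A) (a * S d) (tens H H c l)))"
  "gsw reg_rcoact l (\<lambda>b a. tens (HH A) H (tens H H k b) a) =
    sw l (\<lambda>a b. sw b (\<lambda>c d. tens (HH A) H (tens H H k c) (S a * d)))"
  by (rule gsw_reg_lcoact[of tscale]; intro lin) (rule gsw_reg_rcoact[of tscale]; intro lin)

theorem ydl_H1: "ydl_bimodule A (H1 A)"
proof -
  interpret left_yd A "(*)" reg_lcoact by (rule left_reg)
  interpret right_yd A "\<lambda>l h. sw h (\<lambda>a b. S a * l * b)" "comul A" by (rule right_adj)
  interpret yd_pair A "(*)" reg_lcoact "\<lambda>l h. sw h (\<lambda>a b. S a * l * b)" "comul A" ..
  have "H1 A = pair_data"
    by (simp add: H1_def pair_data_def LA_def RA_def LC_def RC_def fun_eq_iff pure_sw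
        reg_coacts sweedler3_def sw_gsw[symmetric])
  then show ?thesis using ydl_pair by simp
qed

theorem ydl_H2: "ydl_bimodule A (H2 A)"
proof -
  interpret left_yd A "\<lambda>h k. sw h (\<lambda>a b. a * k * S b)" "comul A" by (rule left_adj)
  interpret right_yd A "(*)" reg_rcoact by (rule right_reg)
  interpret yd_pair A "\<lambda>h k. sw h (\<lambda>a b. a * k * S b)" "comul A" "(*)" reg_rcoact ..
  have "H2 A = pair_data"
    by (simp add: H2_def pair_data_def LA_def RA_def LC_def RC_def fun_eq_iff pure_sw
        reg_coacts sweedler3_def sw_gsw[symmetric])
  then show ?thesis using ydl_pair by simp
qed

theorem ydl_H3: "ydl_bimodule A (H3 A)"
proof -
  interpret left_yd A "(*)" reg_lcoact by (rule left_reg)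
  interpret right_yd A "(*)" reg_rcoact by (rule right_reg)
  interpret yd_pair A "(*)" reg_lcoact "(*)" reg_rcoact ..
  have "H3 A = pair_data"
    by (simp add: H3_def pair_data_def LA_def RA_def LC_def RC_def fun_eq_iff pure_sw
        reg_coacts sweedler3_def sw_gsw[symmetric])
  then show ?thesis using ydl_pair by simp
qed

theorem ydl_H4: "ydl_bimodule A (H4 A)"
proof -
  interpret left_yd A "\<lambda>h k. sw h (\<lambda>a b. a * k * S b)" "comul A" by (rule left_adj)
  interpret right_yd A "\<lambda>l h. sw h (\<lambda>a b. S a * l * b)" "comul A" by (rule right_adj)
  interpret yd_pair A "\<lambda>h k. sw h (\<lambda>a b. a * k * S b)" "comul A" "\<lambda>l h. sw h (\<lambda>a b. S a * l * b)" "comul A" ..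
  have "H4 A = pair_data"
    by (simp add: H4_def pair_data_def LA_def RA_def LC_def RC_def fun_eq_iff pure_sw
        reg_coacts sweedler3_def sw_gsw[symmetric])
  then show ?thesis using ydl_pair by simp
qed

end
end

theory Submission
  imports Defs
begin

text \<open>
  Each of the four bimodules is a pair of a left structure on the first tensor factor and a right
  structure on the second, so the map \<open>m \<mapsto> m\<^sub>[\<^sub>-\<^sub>1\<^sub>] \<triangleright> m\<^sub>[\<^sub>0\<^sub>]\<^sub>(\<^sub>0\<^sub>) \<triangleleft> m\<^sub>[\<^sub>0\<^sub>]\<^sub>(\<^sub>1\<^sub>)\<close> is \<open>P \<otimes> Q\<close> for two linear
  maps \<open>P\<close>, \<open>Q\<close> on \<open>H\<close> that fix \<open>1\<close>. Putting \<open>1\<close> in one factor and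
  applying the counit to it shows that \<open>P \<otimes> Q = id\<close> if and only if \<open>P = id\<close> and \<open>Q = id\<close> (\<open>u_condition_pair\<close>).

  Up to coassociativity, \<open>P\<close> is one of \<open>k\<^sub>1 S(k\<^sub>3) k\<^sub>2\<close> and \<open>k\<^sub>1 k\<^sub>3 S(k\<^sub>2)\<close>, and \<open>Q\<close> is one of
  \<open>S(l\<^sub>2) l\<^sub>1 l\<^sub>3\<close> and \<open>l\<^sub>2 S(l\<^sub>1) l\<^sub>3\<close>. Hence \<open>P\<close> is a convolution product \<open>id * f\<close> and \<open>Q\<close> a
  convolution product \<open>f * id\<close>, where \<open>f\<close> is \<open>h \<mapsto> S(h\<^sub>2) h\<^sub>1\<close> or \<open>h \<mapsto> h\<^sub>2 S(h\<^sub>1)\<close>. As \<open>id\<close> is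
  convolution invertible with inverse \<open>S\<close>, such a product is \<open>id\<close> if and only if \<open>f\<close> is the
  convolution unit \<open>h \<mapsto> \<epsilon>(h) 1\<close>. For either \<open>f\<close> this holds if and only if \<open>S\<^sup>2 = id\<close>
  (\<open>sw_S2_1_eq_counit_iff\<close>, \<open>sw_2_S1_eq_counit_iff\<close>).
\<close>

section \<open>Convolution with the identity, and the square of the antipode\<close>

context hopf_algebra
begin

lemma conv_id_left_eq_id_iff:
  assumes f: "lin H sc f"
  shows "(\<forall>h. sw h (\<lambda>a b. a * f b) = h) \<longleftrightarrow> (\<forall>h. f h = sc (e h) 1)"
proof safe
  fix h assume fixes_all: "\<forall>h. sw h (\<lambda>a b. a * f b) = h"
  note [lin] = lin_comp[OF f]
  \<comment> \<open>Convolve with \<open>S\<close>, the inverse of \<open>id\<close>, on the left.\<close>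
  have "f h = sw h (\<lambda>a b. sc (e a) (1 * f b))"
    by (simp add: sw_counit_left[OF f])
  also have "\<dots> = sw h (\<lambda>a b. sw a (\<lambda>x y. S x * y * f b))"
    by (rule sw_cong, rule sw_S_left[of sc "\<lambda>z. z * f b" for b, symmetric]) (intro lin)
  also have "\<dots> = sw h (\<lambda>a b. sw b (\<lambda>x y. S a * x * f y))"
    by (rule sw_coassoc[of sc]) (intro lin)+
  also have "\<dots> = sw h (\<lambda>a b. S a * sw b (\<lambda>x y. x * f y))"
    unfolding mult.assoc
    by (rule sw_cong, rule sw_lin_H[of sc "\<lambda>z. S a * z" for a, symmetric]) (intro lin)
  also have "\<dots> = sc (e h) 1"
    by (simp add: fixes_all antipode_left)
  finally show "f h = sc (e h) 1" .
next
  fix h assume "\<forall>h. f h = sc (e h) 1"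
  then show "sw h (\<lambda>a b. a * f b) = h"
    by (simp add: hscale_mult_right counit_right)
qed

lemma conv_id_right_eq_id_iff:
  assumes f: "lin H sc f"
  shows "(\<forall>h. sw h (\<lambda>a b. f a * b) = h) \<longleftrightarrow> (\<forall>h. f h = sc (e h) 1)"
proof safe
  fix h assume fixes_all: "\<forall>h. sw h (\<lambda>a b. f a * b) = h"
  note [lin] = lin_comp[OF f]
  have "f h = sw h (\<lambda>a b. sc (e b) (f a * 1))"
    by (simp add: sw_counit_right[OF f])
  also have "\<dots> = sw h (\<lambda>a b. sw b (\<lambda>x y. f a * (x * S y)))"
    by (rule sw_cong, rule sw_S_right[of sc "\<lambda>z. f a * z" for a, symmetric]) (intro lin)
  also have "\<dots> = sw h (\<lambda>a b. sw a (\<lambda>x y. f x * (y * S b)))"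
    by (rule sw_coassoc[of sc, symmetric]) (intro lin)+
  also have "\<dots> = sw h (\<lambda>a b. sw a (\<lambda>x y. f x * y) * S b)"
    unfolding mult.assoc[symmetric]
    by (rule sw_cong, rule sw_lin_H[of sc "\<lambda>z. z * S b" for b, symmetric]) (intro lin)
  also have "\<dots> = sc (e h) 1"
    by (simp add: fixes_all antipode_right)
  finally show "f h = sc (e h) 1" .
next
  fix h assume "\<forall>h. f h = sc (e h) 1"
  then show "sw h (\<lambda>a b. f a * b) = h"
    by (simp add: hscale_mult_left counit_left)
qed

lemma S_scale: "S (sc c x) = sc c (S x)"
  using antipode_lin by (simp add: lin_H)

lemma S_sw: "S (sw h F) = sw h (\<lambda>a b. S (F a b))"
  by (rule sw_lin_H[OF antipode_lin])

text \<open>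
  If \<open>S(h\<^sub>2) h\<^sub>1 = \<epsilon>(h) 1\<close>, then evaluating \<open>S\<^sup>2(h\<^sub>3) S(h\<^sub>2) h\<^sub>1\<close> with its two bracketings
  yields \<open>S\<^sup>2(h)\<close> and \<open>h\<close>. Conversely, if \<open>S\<^sup>2 = id\<close>, then applying \<open>S\<close> to
  \<open>S(h\<^sub>1) h\<^sub>2 = \<epsilon>(h) 1\<close> gives \<open>S(h\<^sub>2) h\<^sub>1 = \<epsilon>(h) 1\<close>.
\<close>

lemma sw_S2_1_eq_counit_iff:
  "(\<forall>h. sw h (\<lambda>a b. S b * a) = sc (e h) 1) \<longleftrightarrow> S \<circ> S = id"
proof
  assume unit: "\<forall>h. sw h (\<lambda>a b. S b * a) = sc (e h) 1"
  have SS: "sw h (\<lambda>a b. S (S b) * S a) = sc (e h) 1" for h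
    using arg_cong[OF antipode_right[of h], of S] by (simp add: S_sw S_mult S_scale S_one)
  have "S (S h) = h" for h
  proof -
    have "S (S h) = sw h (\<lambda>a b. sc (e a) (S (S b)))"
      by (rule sw_counit_left[symmetric]) (intro lin)
    also have "\<dots> = sw h (\<lambda>a b. S (S b) * sw a (\<lambda>x y. S y * x))"
      by (simp add: unit hscale_mult_right)
    also have "\<dots> = sw h (\<lambda>a b. sw a (\<lambda>x y. S (S b) * (S y * x)))"
      by (rule sw_cong, rule sw_lin_H[of sc "\<lambda>z. S (S b) * z" for b]) (intro lin)
    also have "\<dots> = sw h (\<lambda>a b. sw b (\<lambda>x y. S (S y) * (S x * a)))"
      by (rule sw_coassoc[of sc]) (intro lin)+
    also have "\<dots> = sw h (\<lambda>a b. sw b (\<lambda>x y. S (S y) * S x) * a)"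
      unfolding mult.assoc[symmetric]
      by (rule sw_cong, rule sw_lin_H[of sc "\<lambda>z. z * a" for a, symmetric]) (intro lin)
    also have "\<dots> = h"
      by (simp add: SS hscale_mult_left counit_right)
    finally show ?thesis .
  qed
  then show "S \<circ> S = id" by (simp add: fun_eq_iff)
next
  assume "S \<circ> S = id"
  then have "S (S x) = x" for x by (simp add: fun_eq_iff)
  then show "\<forall>h. sw h (\<lambda>a b. S b * a) = sc (e h) 1"
    using arg_cong[OF antipode_left, of S] by (simp add: S_sw S_mult S_scale S_one)
qed

text \<open>The mirror image, with \<open>h\<^sub>3 S(h\<^sub>2) S\<^sup>2(h\<^sub>1)\<close> and \<open>h\<^sub>1 S(h\<^sub>2) = \<epsilon>(h) 1\<close>.\<close>

lemma sw_2_S1_eq_counit_iff: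
  "(\<forall>h. sw h (\<lambda>a b. b * S a) = sc (e h) 1) \<longleftrightarrow> S \<circ> S = id"
proof
  assume unit: "\<forall>h. sw h (\<lambda>a b. b * S a) = sc (e h) 1"
  have SS: "sw h (\<lambda>a b. S b * S (S a)) = sc (e h) 1" for h
    using arg_cong[OF antipode_left[of h], of S] by (simp add: S_sw S_mult S_scale S_one)
  have "S (S h) = h" for h
  proof -
    have "S (S h) = sw h (\<lambda>a b. sc (e b) (S (S a)))"
      by (rule sw_counit_right[symmetric]) (intro lin)
    also have "\<dots> = sw h (\<lambda>a b. sw b (\<lambda>x y. y * S x) * S (S a))"
      by (simp add: unit hscale_mult_left)
    also have "\<dots> = sw h (\<lambda>a b. sw b (\<lambda>x y. y * S x * S (S a)))"
      by (rule sw_cong, rule sw_lin_H[of sc "\<lambda>z. z * S (S a)" for a]) (intro lin)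
    also have "\<dots> = sw h (\<lambda>a b. sw a (\<lambda>x y. b * S y * S (S x)))"
      by (rule sw_coassoc[of sc, symmetric]) (intro lin)+
    also have "\<dots> = sw h (\<lambda>a b. b * sw a (\<lambda>x y. S y * S (S x)))"
      unfolding mult.assoc
      by (rule sw_cong, rule sw_lin_H[of sc "\<lambda>z. b * z" for b, symmetric]) (intro lin)
    also have "\<dots> = h"
      by (simp add: SS hscale_mult_right counit_left)
    finally show ?thesis .
  qed
  then show "S \<circ> S = id" by (simp add: fun_eq_iff)
next
  assume "S \<circ> S = id"
  then have "S (S x) = x" for x by (simp add: fun_eq_iff)
  then show "\<forall>h. sw h (\<lambda>a b. b * S a) = sc (e h) 1"
    using arg_cong[OF antipode_right, of S] by (simp add: S_sw S_mult S_scale S_one)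
qed

lemma pure_one_right_inject: "tens H H x 1 = tens H H y 1 \<Longrightarrow> x = y"
proof -
  assume eq: "tens H H x 1 = tens H H y 1"
  obtain \<phi> where "\<And>a b. \<phi> (tens H H a b) = sc (e b) a"
    by (rule transfer2[of sc "\<lambda>a b. sc (e b) a"]) (intro lin | blast)+
  then have "\<phi> (tens H H z 1) = z" for z by (simp add: counit_one)
  with eq show ?thesis by metis
qed

lemma pure_one_left_inject: "tens H H 1 x = tens H H 1 y \<Longrightarrow> x = y"
proof -
  assume eq: "tens H H 1 x = tens H H 1 y"
  obtain \<phi> where "\<And>a b. \<phi> (tens H H a b) = sc (e a) b"
    by (rule transfer2[of sc "\<lambda>a b. sc (e a) b"]) (intro lin | blast)+
  then have "\<phi> (tens H H 1 z) = z" for z by (simp add: counit_one)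
  with eq show ?thesis by metis
qed

end

section \<open>The map of the u-condition on a pair of structures\<close>

context left_yd
begin

text \<open>The map \<open>k \<mapsto> k\<^sub>[\<^sub>-\<^sub>1\<^sub>] \<triangleright> k\<^sub>[\<^sub>0\<^sub>]\<close> of the left structure.\<close>

definition lmap :: "'h \<Rightarrow> 'h" where "lmap k = gsw cl k la"

end

context right_yd
begin

text \<open>The map \<open>l \<mapsto> l\<^sub>(\<^sub>0\<^sub>) \<triangleleft> l\<^sub>(\<^sub>1\<^sub>)\<close> of the right structure.\<close>

definition rmap :: "'h \<Rightarrow> 'h" where "rmap l = gsw cr l ra"

end

context yd_pair
begin

lemma u_map_pure:
  "lsw (tens H H k l) (\<lambda>a n. rsw n (\<lambda>p b. RA (LA a p) b)) = tens H H (lmap k) (rmap l)"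
proof -
  have "lsw (tens H H k l) (\<lambda>a n. rsw n (\<lambda>p b. RA (LA a p) b)) =
      gsw cl k (\<lambda>a c. rsw (tens H H c l) (\<lambda>p b. RA (LA a p) b))"
    by (rule lsw) (intro lin; assumption)+
  also have "\<dots> = gsw cl k (\<lambda>a c. gsw cr l (\<lambda>d b. RA (LA a (tens H H c d)) b))"
    by (rule gsw_cong, rule rsw) (intro lin; assumption)+
  also have "\<dots> = gsw cl k (\<lambda>a c. gsw cr l (\<lambda>d b. tens H H (la a c) (ra d b)))"
    by simp
  also have "\<dots> = gsw cl k (\<lambda>a c. tens H H (la a c) (rmap l))"
    unfolding rmap_def
    by (rule gsw_cong, rule gsw_lin_H[of cr tscale "\<lambda>z. tens H H w z" for w, symmetric]) (intro lin)+
  also have "\<dots> = tens H H (lmap k) (rmap l)"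
    unfolding lmap_def
    by (rule gsw_lin_H[of cl tscale "\<lambda>z. tens H H z w" for w, symmetric]) (intro lin)+
  finally show ?thesis .
qed

lemma u_condition_pair:
  assumes "lmap 1 = 1" "rmap 1 = 1"
  shows "u_condition A pair_data \<longleftrightarrow> (\<forall>k. lmap k = k) \<and> (\<forall>l. rmap l = l)"
proof
  assume "u_condition A pair_data"
  then have "lsw (tens H H k l) (\<lambda>a n. rsw n (\<lambda>p b. RA (LA a p) b)) = tens H H k l" for k l
    by (simp add: u_condition_def lsweedler_def rsweedler_def tens_in_tensor)
  then have "tens H H (lmap k) (rmap l) = tens H H k l" for k l
    by (simp add: u_map_pure)
  from this[of _ 1] this[of 1] show "(\<forall>k. lmap k = k) \<and> (\<forall>l. rmap l = l)"
    by (auto simp: assms intro: pure_one_left_inject pure_one_right_inject)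
next
  assume id: "(\<forall>k. lmap k = k) \<and> (\<forall>l. rmap l = l)"
  have "lsw m (\<lambda>a n. rsw n (\<lambda>p b. RA (LA a p) b)) = m" if m: "m \<in> carrier (HH A)" for m
  proof (rule eqI[OF _ _ _ m], (intro lin; assumption)+)
    fix k l
    show "lsw (tens H H k l) (\<lambda>a n. rsw n (\<lambda>p b. RA (LA a p) b)) = tens H H k l"
      by (simp only: u_map_pure id)
  qed
  then show "u_condition A pair_data"
    by (simp add: u_condition_def lsweedler_def rsweedler_def)
qed

end

section \<open>The regular and adjoint structures\<close>

context hopf_algebra
begin

text \<open>
  For each of the two left and two right structures, the map of the structure fixes \<open>1\<close>, and it
  is the identity if and only if \<open>S\<^sup>2 = id\<close>.
\<close>

lemma lmap_reg:
  "left_yd.lmap A (*) reg_lcoact 1 = 1"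
  "(\<forall>k. left_yd.lmap A (*) reg_lcoact k = k) \<longleftrightarrow> S \<circ> S = id"
proof -
  interpret left_yd A "(*)" reg_lcoact by (rule left_reg)
  let ?f = "\<lambda>h. sw h (\<lambda>a b. S b * a)"
  have f: "lin H sc ?f" by (intro lin)
  have "gsw reg_lcoact k (*) = sw k (\<lambda>a b. sw b (\<lambda>c d. a * S d * c))" for k
    by (rule gsw_reg_lcoact[of sc]) (intro lin)+
  also have "\<dots> k = sw k (\<lambda>a b. a * ?f b)" for k
    unfolding mult.assoc
    by (rule sw_cong, rule sw_lin_H[of sc "\<lambda>z. a * z" for a, symmetric]) (intro lin)
  finally have lmap: "lmap k = sw k (\<lambda>a b. a * ?f b)" for k
    unfolding lmap_def .
  have "?f 1 = S 1 * 1" by (rule sw_one[of sc]) (intro lin)+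
  moreover have "lmap 1 = 1 * ?f 1" unfolding lmap by (rule sw_one[of sc]) (intro lin)+
  ultimately show "lmap 1 = 1" by (simp add: S_one)
  show "(\<forall>k. lmap k = k) \<longleftrightarrow> S \<circ> S = id"
    unfolding lmap conv_id_left_eq_id_iff[OF f] by (rule sw_S2_1_eq_counit_iff)
qed

lemma lmap_adj:
  "left_yd.lmap A (\<lambda>h k. sw h (\<lambda>a b. a * k * S b)) (comul A) 1 = 1"
  "(\<forall>k. left_yd.lmap A (\<lambda>h k. sw h (\<lambda>a b. a * k * S b)) (comul A) k = k) \<longleftrightarrow> S \<circ> S = id"
proof -
  interpret left_yd A "\<lambda>h k. sw h (\<lambda>a b. a * k * S b)" "comul A" by (rule left_adj)
  let ?f = "\<lambda>h. sw h (\<lambda>a b. b * S a)"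
  have f: "lin H sc ?f" by (intro lin)
  have "sw k (\<lambda>a b. sw a (\<lambda>x y. x * b * S y)) = sw k (\<lambda>a b. sw b (\<lambda>x y. a * y * S x))" for k
    by (rule sw_coassoc[of sc]) (intro lin)+
  also have "\<dots> k = sw k (\<lambda>a b. a * ?f b)" for k
    unfolding mult.assoc
    by (rule sw_cong, rule sw_lin_H[of sc "\<lambda>z. a * z" for a, symmetric]) (intro lin)
  finally have lmap: "lmap k = sw k (\<lambda>a b. a * ?f b)" for k
    unfolding lmap_def sw_gsw[symmetric] .
  have "?f 1 = 1 * S 1" by (rule sw_one[of sc]) (intro lin)+
  moreover have "lmap 1 = 1 * ?f 1" unfolding lmap by (rule sw_one[of sc]) (intro lin)+
  ultimately show "lmap 1 = 1" by (simp add: S_one)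
  show "(\<forall>k. lmap k = k) \<longleftrightarrow> S \<circ> S = id"
    unfolding lmap conv_id_left_eq_id_iff[OF f] by (rule sw_2_S1_eq_counit_iff)
qed

lemma rmap_reg:
  "right_yd.rmap A (*) reg_rcoact 1 = 1"
  "(\<forall>l. right_yd.rmap A (*) reg_rcoact l = l) \<longleftrightarrow> S \<circ> S = id"
proof -
  interpret right_yd A "(*)" reg_rcoact by (rule right_reg)
  let ?f = "\<lambda>h. sw h (\<lambda>a b. b * S a)"
  have f: "lin H sc ?f" by (intro lin)
  have "gsw reg_rcoact l (*) = sw l (\<lambda>a b. sw b (\<lambda>c d. c * (S a * d)))" for l
    by (rule gsw_reg_rcoact[of sc]) (intro lin)+
  also have "\<dots> l = sw l (\<lambda>a b. sw a (\<lambda>x y. y * (S x * b)))" for l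
    by (rule sw_coassoc[of sc, symmetric]) (intro lin)+
  also have "\<dots> l = sw l (\<lambda>a b. ?f a * b)" for l
    unfolding mult.assoc[symmetric]
    by (rule sw_cong, rule sw_lin_H[of sc "\<lambda>z. z * b" for b, symmetric]) (intro lin)
  finally have rmap: "rmap l = sw l (\<lambda>a b. ?f a * b)" for l
    unfolding rmap_def .
  have "?f 1 = 1 * S 1" by (rule sw_one[of sc]) (intro lin)+
  moreover have "rmap 1 = ?f 1 * 1" unfolding rmap by (rule sw_one[of sc]) (intro lin)+
  ultimately show "rmap 1 = 1" by (simp add: S_one)
  show "(\<forall>l. rmap l = l) \<longleftrightarrow> S \<circ> S = id"
    unfolding rmap conv_id_right_eq_id_iff[OF f] by (rule sw_2_S1_eq_counit_iff)
qed

lemma rmap_adj: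
  "right_yd.rmap A (\<lambda>l h. sw h (\<lambda>a b. S a * l * b)) (comul A) 1 = 1"
  "(\<forall>l. right_yd.rmap A (\<lambda>l h. sw h (\<lambda>a b. S a * l * b)) (comul A) l = l) \<longleftrightarrow> S \<circ> S = id"
proof -
  interpret right_yd A "\<lambda>l h. sw h (\<lambda>a b. S a * l * b)" "comul A" by (rule right_adj)
  let ?f = "\<lambda>h. sw h (\<lambda>a b. S b * a)"
  have f: "lin H sc ?f" by (intro lin)
  have "sw l (\<lambda>a b. sw b (\<lambda>x y. S x * a * y)) = sw l (\<lambda>a b. sw a (\<lambda>x y. S y * x * b))" for l
    by (rule sw_coassoc[of sc, symmetric]) (intro lin)+
  also have "\<dots> l = sw l (\<lambda>a b. ?f a * b)" for l
    by (rule sw_cong, rule sw_lin_H[of sc "\<lambda>z. z * b" for b, symmetric]) (intro lin)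
  finally have rmap: "rmap l = sw l (\<lambda>a b. ?f a * b)" for l
    unfolding rmap_def sw_gsw[symmetric] .
  have "?f 1 = S 1 * 1" by (rule sw_one[of sc]) (intro lin)+
  moreover have "rmap 1 = ?f 1 * 1" unfolding rmap by (rule sw_one[of sc]) (intro lin)+
  ultimately show "rmap 1 = 1" by (simp add: S_one)
  show "(\<forall>l. rmap l = l) \<longleftrightarrow> S \<circ> S = id"
    unfolding rmap conv_id_right_eq_id_iff[OF f] by (rule sw_S2_1_eq_counit_iff)
qed

lemma u_condition_H1: "u_condition A (H1 A) \<longleftrightarrow> S \<circ> S = id"
proof -
  interpret left_yd A "(*)" reg_lcoact by (rule left_reg)
  interpret right_yd A "\<lambda>l h. sw h (\<lambda>a b. S a * l * b)" "comul A" by (rule right_adj)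
  interpret yd_pair A "(*)" reg_lcoact "\<lambda>l h. sw h (\<lambda>a b. S a * l * b)" "comul A" ..
  have "H1 A = pair_data"
    by (simp add: H1_def pair_data_def LA_def RA_def LC_def RC_def fun_eq_iff pure_sw
        reg_coacts sweedler3_def sw_gsw[symmetric])
  then show ?thesis
    using u_condition_pair[OF lmap_reg(1) rmap_adj(1)] lmap_reg(2) rmap_adj(2) by simp
qed

lemma u_condition_H2: "u_condition A (H2 A) \<longleftrightarrow> S \<circ> S = id"
proof -
  interpret left_yd A "\<lambda>h k. sw h (\<lambda>a b. a * k * S b)" "comul A" by (rule left_adj)
  interpret right_yd A "(*)" reg_rcoact by (rule right_reg)
  interpret yd_pair A "\<lambda>h k. sw h (\<lambda>a b. a * k * S b)" "comul A" "(*)" reg_rcoact ..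
  have "H2 A = pair_data"
    by (simp add: H2_def pair_data_def LA_def RA_def LC_def RC_def fun_eq_iff pure_sw
        reg_coacts sweedler3_def sw_gsw[symmetric])
  then show ?thesis
    using u_condition_pair[OF lmap_adj(1) rmap_reg(1)] lmap_adj(2) rmap_reg(2) by simp
qed

lemma u_condition_H3: "u_condition A (H3 A) \<longleftrightarrow> S \<circ> S = id"
proof -
  interpret left_yd A "(*)" reg_lcoact by (rule left_reg)
  interpret right_yd A "(*)" reg_rcoact by (rule right_reg)
  interpret yd_pair A "(*)" reg_lcoact "(*)" reg_rcoact ..
  have "H3 A = pair_data"
    by (simp add: H3_def pair_data_def LA_def RA_def LC_def RC_def fun_eq_iff pure_sw
        reg_coacts sweedler3_def sw_gsw[symmetric])
  then show ?thesis
    using u_condition_pair[OF lmap_reg(1) rmap_reg(1)] lmap_reg(2) rmap_reg(2) by simp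
qed

lemma u_condition_H4: "u_condition A (H4 A) \<longleftrightarrow> S \<circ> S = id"
proof -
  interpret left_yd A "\<lambda>h k. sw h (\<lambda>a b. a * k * S b)" "comul A" by (rule left_adj)
  interpret right_yd A "\<lambda>l h. sw h (\<lambda>a b. S a * l * b)" "comul A" by (rule right_adj)
  interpret yd_pair A "\<lambda>h k. sw h (\<lambda>a b. a * k * S b)" "comul A"
    "\<lambda>l h. sw h (\<lambda>a b. S a * l * b)" "comul A" ..
  have "H4 A = pair_data"
    by (simp add: H4_def pair_data_def LA_def RA_def LC_def RC_def fun_eq_iff pure_sw
        reg_coacts sweedler3_def sw_gsw[symmetric])
  then show ?thesis
    using u_condition_pair[OF lmap_adj(1) rmap_adj(1)] lmap_adj(2) rmap_adj(2) by simp
qed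

end

theorem proposition4p2:
  fixes A :: "('k::field, 'h::ring_1) hopf"
  assumes "hopf_algebra A"
  shows "(u_condition A (H1 A) \<longleftrightarrow> antipode A \<circ> antipode A = id) \<and>
    (u_condition A (H2 A) \<longleftrightarrow> antipode A \<circ> antipode A = id) \<and>
    (u_condition A (H3 A) \<longleftrightarrow> antipode A \<circ> antipode A = id) \<and>
    (u_condition A (H4 A) \<longleftrightarrow> antipode A \<circ> antipode A = id)"
proof -
  interpret hopf_algebra A by fact
  show ?thesis
    using u_condition_H1 u_condition_H2 u_condition_H3 u_condition_H4 by blast
qed

end
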